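(* Let $\mathcal{Q}$ be a small quantaloid, let $\mathbb{A}$ and $\mathbb{B}$ be $\widehat{\mathcal{P}^\dagger}$-algebras, and let $\zeta\colon\mathbb{A}\to\mathbb{B}$ be a left adjoint $\mathcal{Q}$-distributor with right adjoint $\zeta^*\colon\mathbb{B}\to\mathbb{A}$. Then $\zeta$ is a $\widehat{\mathcal{P}^\dagger}$-algebra homomorphism if and only if $\zeta^*$ is a left adjoint $\mathcal{Q}$-distributor.
   Context: A quantaloid $\mathcal{Q}$ is a category whose hom-sets are complete lattices and whose composition preserves arbitrary joins in each variable; here $\mathcal{Q}$ is small, with object set $\mathcal{Q}_0$. For $f\colon X\to Y$, $g\colon Y\to Z$, $h\colon X\to Z$ in $\mathcal{Q}$, the implications are defined by $g\circ f\leq h\iff g\leq h\swarrow f\iff f\leq g\searrow h$. In a quantaloid, $f\colon X\to Y$ is left adjoint to $g\colon Y\to X$ ($f\dashv g$, and $g$ is right adjoint) if $1_X\leq g\circ f$ and $f\circ g\leq 1_Y$; when it exists the right adjoint of $f$ is unique and denoted $f^*$. A $\mathcal{Q}$-category $\mathbb{A}$ is a set $\mathbb{A}_0$ with a type map $|\cdot|\colon\mathbb{A}_0\to\mathcal{Q}_0$ and arrows $\mathbb{A}(x,y)\in\mathcal{Q}(|x|,|y|)$ with $1_{|x|}\leq\mathbb{A}(x,x)$ and $\mathbb{A}(y,z)\circ\mathbb{A}(x,y)\leq\mathbb{A}(x,z)$. A $\mathcal{Q}$-functor $F\colon\mathbb{A}\to\mathbb{B}$ is a type-preserving map with $\mathbb{A}(x,y)\leq\mathbb{B}(Fx,Fy)$.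 A $\mathcal{Q}$-distributor $\varphi\colon\mathbb{A}\to\mathbb{B}$ is a family $\varphi(x,y)\in\mathcal{Q}(|x|,|y|)$ ($x\in\mathbb{A}_0,y\in\mathbb{B}_0$) with $\mathbb{B}(y',y)\circ\varphi(x,y')\leq\varphi(x,y)$ and $\varphi(x',y)\circ\mathbb{A}(x,x')\leq\varphi(x,y)$. With pointwise order, composition $(\psi\circ\varphi)(x,z)=\bigvee_{y}\psi(y,z)\circ\varphi(x,y)$ and identities $\mathbb{A}$ (the hom-arrows), $\mathcal{Q}$-categories and $\mathcal{Q}$-distributors form a quantaloid $\mathcal{Q}\text{-}\mathbf{Dist}$; left/right adjoint $\mathcal{Q}$-distributors and implications of distributors are taken in this quantaloid. $\mathbf{Map}(\mathcal{Q}\text{-}\mathbf{Dist})$ is its subcategory of all $\mathcal{Q}$-categories and left adjoint $\mathcal{Q}$-distributors. A $\mathcal{Q}$-functor $F\colon\mathbb{A}\to\mathbb{B}$ has graph $F_\natural\colon\mathbb{A}\to\mathbb{B}$, $F_\natural(x,y)=\mathbb{B}(Fx,y)$, and cograph $F^\natural\colon\mathbb{B}\to\mathbb{A}$, $F^\natural(y,x)=\mathbb{B}(y,Fx)$, with $F_\natural\dashv F^\natural$. $*_X$ is the $\mathcal{Q}$-category with one object of type $X$ and hom-arrow $1_X$. The copresheaf category $\mathcal{P}^\dagger\mathbb{A}$ has as objects of type $X$ the $\mathcal{Q}$-distributors $\lambda\colon *_X\to\mathbb{A}$, with $\mathcal{P}^\dagger\mathbb{A}(\lambda,\lambda')=\lambda'\searrow\lambda$.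 The co-Yoneda embedding is $\mathsf{Y}^\dagger_{\mathbb{A}}\colon\mathbb{A}\to\mathcal{P}^\dagger\mathbb{A}$, $a\mapsto\mathbb{A}(a,-)$. The copresheaf monad $(\widehat{\mathcal{P}^\dagger},\mathsf{m}^\dagger,\iota^\dagger)$ on $\mathbf{Map}(\mathcal{Q}\text{-}\mathbf{Dist})$: $\widehat{\mathcal{P}^\dagger}\mathbb{A}=\mathcal{P}^\dagger\mathbb{A}$; for a left adjoint $\zeta\colon\mathbb{A}\to\mathbb{B}$, $\widehat{\mathcal{P}^\dagger}\zeta=(\zeta_\dagger)_\natural$, where $\zeta_\dagger\colon\mathcal{P}^\dagger\mathbb{A}\to\mathcal{P}^\dagger\mathbb{B}$ is the $\mathcal{Q}$-functor $\mu\mapsto\zeta\circ\mu$; $\iota^\dagger_{\mathbb{A}}=(\mathsf{Y}^\dagger_{\mathbb{A}})_\natural$; $\mathsf{m}^\dagger_{\mathbb{A}}=(\inf_{\mathcal{P}^\dagger\mathbb{A}})_\natural$, where $\inf_{\mathcal{P}^\dagger\mathbb{A}}(\Psi)=(\mathsf{Y}^\dagger_{\mathbb{A}})^\natural\circ\Psi$. A $\widehat{\mathcal{P}^\dagger}$-algebra is a pair $(\mathbb{A},\varphi)$ with $\varphi\colon\mathcal{P}^\dagger\mathbb{A}\to\mathbb{A}$ a $\mathcal{Q}$-distributor that is left adjoint to $(\mathsf{Y}^\dagger_{\mathbb{A}})_\natural$ (so $\varphi$ is uniquely determined by $\mathbb{A}$). A $\widehat{\mathcal{P}^\dagger}$-algebra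 homomorphism from $(\mathbb{A},\varphi)$ to $(\mathbb{B},\psi)$ is a left adjoint $\mathcal{Q}$-distributor $\zeta\colon\mathbb{A}\to\mathbb{B}$ with $\psi\circ\widehat{\mathcal{P}^\dagger}\zeta=\zeta\circ\varphi$. *)

theory Defs
  imports "HOL-Algebra.Complete_Lattice" "HOL-Library.FuncSet"
begin

section \<open>Small quantaloids\<close>

text \<open>
  The hom-sets are cut out of one set of arrows by source and target, so distinct hom-sets are
  disjoint. Only the values of \<open>leq\<close> on parallel arrows matter.
  Composition is written in applicative order: \<open>cmp Q g f\<close> is \<open>g \<circ> f\<close>.
\<close>

record ('o, 'm) quantaloid_data =
  ob :: "'o set"
  arr :: "'m set"
  src :: "'m \<Rightarrow> 'o"
  trg :: "'m \<Rightarrow> 'o"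
  idt :: "'o \<Rightarrow> 'm"
  cmp :: "'m \<Rightarrow> 'm \<Rightarrow> 'm"
  leq :: "'m \<Rightarrow> 'm \<Rightarrow> bool"

definition Hom :: "('o, 'm) quantaloid_data \<Rightarrow> 'o \<Rightarrow> 'o \<Rightarrow> 'm set" where
  "Hom Q X Y = {f \<in> arr Q. src Q f = X \<and> trg Q f = Y}"

definition hom_order :: "('o, 'm) quantaloid_data \<Rightarrow> 'o \<Rightarrow> 'o \<Rightarrow> 'm gorder" where
  "hom_order Q X Y = \<lparr>carrier = Hom Q X Y, eq = (=), le = leq Q\<rparr>"

definition hom_join :: "('o, 'm) quantaloid_data \<Rightarrow> 'o \<Rightarrow> 'o \<Rightarrow> 'm set \<Rightarrow> 'm" where
  "hom_join Q X Y S = \<Squnion>\<^bsub>hom_order Q X Y\<^esub> S"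

locale quantaloid =
  fixes Q :: "('o, 'm) quantaloid_data"
  assumes src_ob: "f \<in> arr Q \<Longrightarrow> src Q f \<in> ob Q"
    and trg_ob: "f \<in> arr Q \<Longrightarrow> trg Q f \<in> ob Q"
    and idt_Hom: "X \<in> ob Q \<Longrightarrow> idt Q X \<in> Hom Q X X"
    and cmp_Hom: "f \<in> Hom Q X Y \<Longrightarrow> g \<in> Hom Q Y Z \<Longrightarrow> cmp Q g f \<in> Hom Q X Z"
    and cmp_idt: "f \<in> Hom Q X Y \<Longrightarrow> cmp Q f (idt Q X) = f"
    and idt_cmp: "f \<in> Hom Q X Y \<Longrightarrow> cmp Q (idt Q Y) f = f"
    and cmp_assoc: "f \<in> Hom Q W X \<Longrightarrow> g \<in> Hom Q X Y \<Longrightarrow> h \<in> Hom Q Y Z \<Longrightarrow>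
          cmp Q h (cmp Q g f) = cmp Q (cmp Q h g) f"
    and hom_complete: "X \<in> ob Q \<Longrightarrow> Y \<in> ob Q \<Longrightarrow> complete_lattice (hom_order Q X Y)"
    and cmp_join_right: "S \<subseteq> Hom Q X Y \<Longrightarrow> g \<in> Hom Q Y Z \<Longrightarrow> X \<in> ob Q \<Longrightarrow>
          cmp Q g (hom_join Q X Y S) = hom_join Q X Z ((\<lambda>f. cmp Q g f) ` S)"
    and cmp_join_left: "S \<subseteq> Hom Q Y Z \<Longrightarrow> f \<in> Hom Q X Y \<Longrightarrow> Z \<in> ob Q \<Longrightarrow>
          cmp Q (hom_join Q Y Z S) f = hom_join Q X Z ((\<lambda>g. cmp Q g f) ` S)"


section \<open>Categories enriched in a quantaloid\<close>

record ('o, 'a, 'm) qcat_data =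
  obj :: "'a set"
  tp :: "'a \<Rightarrow> 'o"
  hm :: "'a \<Rightarrow> 'a \<Rightarrow> 'm"

definition qcategory :: "('o, 'm) quantaloid_data \<Rightarrow> ('o, 'a, 'm) qcat_data \<Rightarrow> bool" where
  "qcategory Q A \<longleftrightarrow>
     (\<forall>x\<in>obj A. tp A x \<in> ob Q) \<and>
     (\<forall>x\<in>obj A. \<forall>y\<in>obj A. hm A x y \<in> Hom Q (tp A x) (tp A y)) \<and>
     (\<forall>x\<in>obj A. leq Q (idt Q (tp A x)) (hm A x x)) \<and>
     (\<forall>x\<in>obj A. \<forall>y\<in>obj A. \<forall>z\<in>obj A. leq Q (cmp Q (hm A y z) (hm A x y)) (hm A x z))"


section \<open>Distributors\<close>

text \<open>
  A distributor is an extensional function on the product of the object sets (it is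
  \<open>undefined\<close> elsewhere), so that HOL equality of distributors is equality of the families.
\<close>

definition Dist :: "('o, 'm) quantaloid_data \<Rightarrow> ('o, 'a, 'm) qcat_data \<Rightarrow>
    ('o, 'b, 'm) qcat_data \<Rightarrow> ('a \<times> 'b \<Rightarrow> 'm) set" where
  "Dist Q A B = {\<phi> \<in> (\<Pi>\<^sub>E (x, y) \<in> obj A \<times> obj B. Hom Q (tp A x) (tp B y)).
     (\<forall>x\<in>obj A. \<forall>y'\<in>obj B. \<forall>y\<in>obj B. leq Q (cmp Q (hm B y' y) (\<phi> (x, y'))) (\<phi> (x, y))) \<and>
     (\<forall>x\<in>obj A. \<forall>x'\<in>obj A. \<forall>y\<in>obj B. leq Q (cmp Q (\<phi> (x', y)) (hm A x x')) (\<phi> (x, y)))}"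

definition dist_le :: "('o, 'm) quantaloid_data \<Rightarrow> ('o, 'a, 'm) qcat_data \<Rightarrow>
    ('o, 'b, 'm) qcat_data \<Rightarrow> ('a \<times> 'b \<Rightarrow> 'm) \<Rightarrow> ('a \<times> 'b \<Rightarrow> 'm) \<Rightarrow> bool" where
  "dist_le Q A B \<phi> \<psi> \<longleftrightarrow> (\<forall>x\<in>obj A. \<forall>y\<in>obj B. leq Q (\<phi> (x, y)) (\<psi> (x, y)))"

definition dist_id :: "('o, 'a, 'm) qcat_data \<Rightarrow> 'a \<times> 'a \<Rightarrow> 'm" where
  "dist_id A = (\<lambda>(x, y) \<in> obj A \<times> obj A. hm A x y)"

text \<open>\<open>dist_comp Q A B C \<psi> \<phi>\<close> is \<open>\<psi> \<circ> \<phi>\<close> for \<open>\<phi> : A \<rightarrow> B\<close> and \<open>\<psi> : B \<rightarrow> C\<close>.\<close>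

definition dist_comp :: "('o, 'm) quantaloid_data \<Rightarrow> ('o, 'a, 'm) qcat_data \<Rightarrow>
    ('o, 'b, 'm) qcat_data \<Rightarrow> ('o, 'c, 'm) qcat_data \<Rightarrow>
    ('b \<times> 'c \<Rightarrow> 'm) \<Rightarrow> ('a \<times> 'b \<Rightarrow> 'm) \<Rightarrow> 'a \<times> 'c \<Rightarrow> 'm" where
  "dist_comp Q A B C \<psi> \<phi> = (\<lambda>(x, z) \<in> obj A \<times> obj C.
     hom_join Q (tp A x) (tp C z) ((\<lambda>y. cmp Q (\<psi> (y, z)) (\<phi> (x, y))) ` obj B))"

text \<open>
  The implication \<open>\<gamma> \<searrow> \<eta> : A \<rightarrow> B\<close> of \<open>\<gamma> : B \<rightarrow> C\<close> and \<open>\<eta> : A \<rightarrow> C\<close>, given by its universal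
  property \<open>\<gamma> \<circ> \<phi> \<le> \<eta> \<longleftrightarrow> \<phi> \<le> \<gamma> \<searrow> \<eta>\<close> in the quantaloid of distributors.
\<close>

definition dist_imp :: "('o, 'm) quantaloid_data \<Rightarrow> ('o, 'a, 'm) qcat_data \<Rightarrow>
    ('o, 'b, 'm) qcat_data \<Rightarrow> ('o, 'c, 'm) qcat_data \<Rightarrow>
    ('b \<times> 'c \<Rightarrow> 'm) \<Rightarrow> ('a \<times> 'c \<Rightarrow> 'm) \<Rightarrow> 'a \<times> 'b \<Rightarrow> 'm" where
  "dist_imp Q A B C \<gamma> \<eta> = (THE \<theta>. \<theta> \<in> Dist Q A B \<and>
     (\<forall>\<phi> \<in> Dist Q A B. dist_le Q A C (dist_comp Q A B C \<gamma> \<phi>) \<eta> \<longleftrightarrow> dist_le Q A B \<phi> \<theta>))"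

definition adjoint :: "('o, 'm) quantaloid_data \<Rightarrow> ('o, 'a, 'm) qcat_data \<Rightarrow>
    ('o, 'b, 'm) qcat_data \<Rightarrow> ('a \<times> 'b \<Rightarrow> 'm) \<Rightarrow> ('b \<times> 'a \<Rightarrow> 'm) \<Rightarrow> bool" where
  "adjoint Q A B \<zeta> \<xi> \<longleftrightarrow> \<zeta> \<in> Dist Q A B \<and> \<xi> \<in> Dist Q B A \<and>
     dist_le Q A A (dist_id A) (dist_comp Q A B A \<xi> \<zeta>) \<and>
     dist_le Q B B (dist_comp Q B A B \<zeta> \<xi>) (dist_id B)"

definition left_adjoint :: "('o, 'm) quantaloid_data \<Rightarrow> ('o, 'a, 'm) qcat_data \<Rightarrow>
    ('o, 'b, 'm) qcat_data \<Rightarrow> ('a \<times> 'b \<Rightarrow> 'm) \<Rightarrow> bool" where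
  "left_adjoint Q A B \<zeta> \<longleftrightarrow> (\<exists>\<xi>. adjoint Q A B \<zeta> \<xi>)"

text \<open>The graph \<open>F\<^sub>\<natural>\<close> of a functor \<open>F : A \<rightarrow> B\<close>.\<close>

definition dist_graph :: "('o, 'a, 'm) qcat_data \<Rightarrow> ('o, 'b, 'm) qcat_data \<Rightarrow>
    ('a \<Rightarrow> 'b) \<Rightarrow> 'a \<times> 'b \<Rightarrow> 'm" where
  "dist_graph A B F = (\<lambda>(x, y) \<in> obj A \<times> obj B. hm B (F x) y)"


section \<open>Copresheaves\<close>

definition star :: "('o, 'm) quantaloid_data \<Rightarrow> 'o \<Rightarrow> ('o, unit, 'm) qcat_data" where
  "star Q X = \<lparr>obj = {()}, tp = (\<lambda>_. X), hm = (\<lambda>_ _. idt Q X)\<rparr>"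

text \<open>
  A copresheaf is stored together with its type \<open>X\<close>, since a distributor out of \<open>star Q X\<close>
  does not determine \<open>X\<close> when \<open>A\<close> has no objects. A distributor between \<open>star Q X\<close> and
  \<open>star Q Y\<close> is identified with its only component, an arrow from \<open>X\<close> to \<open>Y\<close>.
\<close>

type_synonym ('o, 'a, 'm) copresheaf = "'o \<times> (unit \<times> 'a \<Rightarrow> 'm)"

definition copsh :: "('o, 'm) quantaloid_data \<Rightarrow> ('o, 'a, 'm) qcat_data \<Rightarrow>
    ('o, ('o, 'a, 'm) copresheaf, 'm) qcat_data" where
  "copsh Q A = \<lparr>obj = (SIGMA X : ob Q. Dist Q (star Q X) A),
     tp = fst,
     hm = (\<lambda>(X, \<mu>) (Y, \<nu>). dist_imp Q (star Q X) (star Q Y) A \<nu> \<mu> ((), ()))\<rparr>"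

definition coyoneda :: "('o, 'a, 'm) qcat_data \<Rightarrow> 'a \<Rightarrow> ('o, 'a, 'm) copresheaf" where
  "coyoneda A a = (tp A a, \<lambda>(u, y) \<in> UNIV \<times> obj A. hm A a y)"

definition copsh_push :: "('o, 'm) quantaloid_data \<Rightarrow> ('o, 'a, 'm) qcat_data \<Rightarrow>
    ('o, 'b, 'm) qcat_data \<Rightarrow> ('a \<times> 'b \<Rightarrow> 'm) \<Rightarrow>
    ('o, 'a, 'm) copresheaf \<Rightarrow> ('o, 'b, 'm) copresheaf" where
  "copsh_push Q A B \<zeta> = (\<lambda>(X, \<mu>). (X, dist_comp Q (star Q X) A B \<zeta> \<mu>))"

text \<open>The action of the copresheaf monad on a left adjoint distributor \<open>\<zeta> : A \<rightarrow> B\<close>.\<close>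

definition copsh_map :: "('o, 'm) quantaloid_data \<Rightarrow> ('o, 'a, 'm) qcat_data \<Rightarrow>
    ('o, 'b, 'm) qcat_data \<Rightarrow> ('a \<times> 'b \<Rightarrow> 'm) \<Rightarrow>
    ('o, 'a, 'm) copresheaf \<times> ('o, 'b, 'm) copresheaf \<Rightarrow> 'm" where
  "copsh_map Q A B \<zeta> = dist_graph (copsh Q A) (copsh Q B) (copsh_push Q A B \<zeta>)"

definition copsh_unit :: "('o, 'm) quantaloid_data \<Rightarrow> ('o, 'a, 'm) qcat_data \<Rightarrow>
    'a \<times> ('o, 'a, 'm) copresheaf \<Rightarrow> 'm" where
  "copsh_unit Q A = dist_graph A (copsh Q A) (coyoneda A)"

definition copsh_algebra :: "('o, 'm) quantaloid_data \<Rightarrow> ('o, 'a, 'm) qcat_data \<Rightarrow>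
    (('o, 'a, 'm) copresheaf \<times> 'a \<Rightarrow> 'm) \<Rightarrow> bool" where
  "copsh_algebra Q A \<phi> \<longleftrightarrow> qcategory Q A \<and> adjoint Q (copsh Q A) A \<phi> (copsh_unit Q A)"

definition copsh_algebra_hom :: "('o, 'm) quantaloid_data \<Rightarrow>
    ('o, 'a, 'm) qcat_data \<Rightarrow> (('o, 'a, 'm) copresheaf \<times> 'a \<Rightarrow> 'm) \<Rightarrow>
    ('o, 'b, 'm) qcat_data \<Rightarrow> (('o, 'b, 'm) copresheaf \<times> 'b \<Rightarrow> 'm) \<Rightarrow>
    ('a \<times> 'b \<Rightarrow> 'm) \<Rightarrow> bool" where
  "copsh_algebra_hom Q A \<phi> B \<psi> \<zeta> \<longleftrightarrow> left_adjoint Q A B \<zeta> \<and>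
     dist_comp Q (copsh Q A) (copsh Q B) B \<psi> (copsh_map Q A B \<zeta>) =
     dist_comp Q (copsh Q A) A B \<zeta> \<phi>"

end

theory Submission
  imports Defs
begin

text \<open>
  Write \<open>T\<close> for the action of the copresheaf construction on distributors (\<open>copsh_map\<close>) and \<open>\<iota>\<close>
  for its unit (\<open>copsh_unit\<close>). The theorem comes from a characterisation of left adjoints by \<open>\<iota>\<close>:
  for every distributor \<open>\<sigma> : A \<rightarrow> B\<close>, adjoint or not, \<open>T \<sigma>\<close> is the graph of the functor
  \<open>\<mu> \<mapsto> \<sigma> \<circ> \<mu>\<close>, hence a left adjoint, and \<open>\<iota>\<close> is always oplax natural,
  \<open>\<iota>\<^sub>B \<circ> \<sigma> \<le> T \<sigma> \<circ> \<iota>\<^sub>A\<close> (\<open>copsh_unit_oplax_natural\<close>). The converse inequality holds exactly when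
  \<open>\<sigma>\<close> is a left adjoint (\<open>copsh_unit_lax_natural_iff_left_adjoint\<close>):

  \<^item> If \<open>\<sigma> \<stileturn> \<xi>\<close>, then \<open>T \<sigma> \<stileturn> T \<xi>\<close> (\<open>copsh_map_adjoint\<close>), so oplax naturality at \<open>\<xi>\<close>, that is
    \<open>\<iota>\<^sub>A \<circ> \<xi> \<le> T \<xi> \<circ> \<iota>\<^sub>B\<close>, transposes to \<open>T \<sigma> \<circ> \<iota>\<^sub>A \<le> \<iota>\<^sub>B \<circ> \<sigma>\<close>.
  \<^item> If equality holds, then \<open>\<iota>\<^sub>B \<circ> \<sigma> = T \<sigma> \<circ> \<iota>\<^sub>A\<close> is a composite of two graphs, so it has a right
    adjoint \<open>\<rho>\<close>. Since the co-Yoneda embedding is fully faithful, \<open>\<iota>\<^sub>B\<close> can be cancelled: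
    \<open>\<sigma> \<stileturn> \<rho> \<circ> \<iota>\<^sub>B\<close> (\<open>adjoint_cancel_embedding\<close>).

  For algebras \<open>\<phi> \<stileturn> \<iota>\<^sub>A\<close> and \<open>\<psi> \<stileturn> \<iota>\<^sub>B\<close>, the inequality \<open>\<psi> \<circ> T \<sigma> \<le> \<sigma> \<circ> \<phi>\<close> is the transpose of
  \<open>T \<sigma> \<circ> \<iota>\<^sub>A \<le> \<iota>\<^sub>B \<circ> \<sigma>\<close>, so it too says that \<open>\<sigma>\<close> is a left adjoint. Now let \<open>\<zeta> \<stileturn> \<zeta>'\<close>. One half of
  the homomorphism equation is this inequality at \<open>\<zeta>\<close> and holds automatically. The other half,
  \<open>\<zeta> \<circ> \<phi> \<le> \<psi> \<circ> T \<zeta>\<close>, transposes along \<open>\<zeta> \<stileturn> \<zeta>'\<close> and \<open>T \<zeta> \<stileturn> T \<zeta>'\<close> to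
  \<open>\<phi> \<circ> T \<zeta>' \<le> \<zeta>' \<circ> \<psi>\<close>, which is the same inequality at \<open>\<zeta>'\<close>: it says that \<open>\<zeta>'\<close> is a left adjoint.
\<close>

section \<open>Order and composition in the base\<close>

context quantaloid
begin

lemma Hom_ob:
  assumes "f \<in> Hom Q X Y"
  shows "X \<in> ob Q" "Y \<in> ob Q"
  using assms src_ob trg_ob by (auto simp: Hom_def)

lemma hom_order_simps [simp]:
  "carrier (hom_order Q X Y) = Hom Q X Y" "eq (hom_order Q X Y) = (=)"
  "le (hom_order Q X Y) = leq Q"
  by (simp_all add: hom_order_def)

lemma leq_refl: "f \<in> Hom Q X Y \<Longrightarrow> leq Q f f"
proof -
  assume f: "f \<in> Hom Q X Y"
  interpret complete_lattice "hom_order Q X Y" by (rule hom_complete[OF Hom_ob[OF f]])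
  show ?thesis using f le_refl by simp
qed

lemma leq_trans:
  assumes "leq Q f g" "leq Q g h" and f: "f \<in> Hom Q X Y" "g \<in> Hom Q X Y" "h \<in> Hom Q X Y"
  shows "leq Q f h"
proof -
  interpret complete_lattice "hom_order Q X Y" by (rule hom_complete[OF Hom_ob[OF f(1)]])
  show ?thesis using assms le_trans[of f g h] by simp
qed

lemma leq_antisym:
  assumes "leq Q f g" "leq Q g f" and f: "f \<in> Hom Q X Y" "g \<in> Hom Q X Y"
  shows "f = g"
proof -
  interpret complete_lattice "hom_order Q X Y" by (rule hom_complete[OF Hom_ob[OF f(1)]])
  show ?thesis using assms le_antisym[of f g] by simp
qed

lemma hom_join_Hom:
  assumes "S \<subseteq> Hom Q X Y" and X: "X \<in> ob Q" "Y \<in> ob Q"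
  shows "hom_join Q X Y S \<in> Hom Q X Y"
proof -
  interpret complete_lattice "hom_order Q X Y" by (rule hom_complete[OF X])
  show ?thesis using assms sup_closed unfolding hom_join_def by simp
qed

lemma hom_join_upper:
  assumes "f \<in> S" "S \<subseteq> Hom Q X Y"
  shows "leq Q f (hom_join Q X Y S)"
proof -
  have f: "f \<in> Hom Q X Y" using assms by blast
  interpret complete_lattice "hom_order Q X Y" by (rule hom_complete[OF Hom_ob[OF f]])
  show ?thesis using assms sup_upper[of S f] unfolding hom_join_def by simp
qed

lemma hom_join_least:
  assumes "S \<subseteq> Hom Q X Y" "h \<in> Hom Q X Y" "\<And>f. f \<in> S \<Longrightarrow> leq Q f h"
  shows "leq Q (hom_join Q X Y S) h"
proof -
  interpret complete_lattice "hom_order Q X Y" by (rule hom_complete[OF Hom_ob[OF assms(2)]])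
  show ?thesis using assms sup_least[of S h] unfolding hom_join_def by (simp add: Upper_def subset_iff)
qed

lemma hom_join_pair:
  assumes "leq Q f f'" "f \<in> Hom Q X Y" "f' \<in> Hom Q X Y"
  shows "hom_join Q X Y {f, f'} = f'"
proof (rule leq_antisym)
  show "leq Q (hom_join Q X Y {f, f'}) f'"
    by (rule hom_join_least) (use assms leq_refl[OF assms(3)] in auto)
  show "leq Q f' (hom_join Q X Y {f, f'})"
    by (rule hom_join_upper) (use assms in auto)
  show "hom_join Q X Y {f, f'} \<in> Hom Q X Y"
    by (rule hom_join_Hom[OF _ Hom_ob[OF assms(2)]]) (use assms in auto)
qed (use assms in auto)

lemma cmp_mono_right:
  assumes "leq Q f f'" "f \<in> Hom Q X Y" "f' \<in> Hom Q X Y" "g \<in> Hom Q Y Z"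
  shows "leq Q (cmp Q g f) (cmp Q g f')"
proof -
  have "cmp Q g f' = hom_join Q X Z ((\<lambda>f. cmp Q g f) ` {f, f'})"
    using cmp_join_right[of "{f, f'}" X Y g Z] hom_join_pair[OF assms(1-3)] assms(2-4)
      Hom_ob(1)[OF assms(2)] by simp
  then show ?thesis
    using hom_join_upper[of "cmp Q g f" "(\<lambda>f. cmp Q g f) ` {f, f'}" X Z]
      cmp_Hom[OF assms(2,4)] cmp_Hom[OF assms(3,4)] by simp
qed

lemma cmp_mono_left:
  assumes "leq Q g g'" "g \<in> Hom Q Y Z" "g' \<in> Hom Q Y Z" "f \<in> Hom Q X Y"
  shows "leq Q (cmp Q g f) (cmp Q g' f)"
proof -
  have "cmp Q g' f = hom_join Q X Z ((\<lambda>g. cmp Q g f) ` {g, g'})"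
    using cmp_join_left[of "{g, g'}" Y Z f X] hom_join_pair[OF assms(1-3)] assms(2-4)
      Hom_ob(2)[OF assms(2)] by simp
  then show ?thesis
    using hom_join_upper[of "cmp Q g f" "(\<lambda>g. cmp Q g f) ` {g, g'}" X Z]
      cmp_Hom[OF assms(4,2)] cmp_Hom[OF assms(4,3)] by simp
qed

lemma cmp_mono:
  assumes "leq Q f f'" "leq Q g g'" and H: "f \<in> Hom Q X Y" "f' \<in> Hom Q X Y"
    "g \<in> Hom Q Y Z" "g' \<in> Hom Q Y Z"
  shows "leq Q (cmp Q g f) (cmp Q g' f')"
  by (rule leq_trans[OF cmp_mono_right[OF assms(1) H(1,2,3)] cmp_mono_left[OF assms(2) H(3,4,2)]
        cmp_Hom[OF H(1,3)] cmp_Hom[OF H(2,3)] cmp_Hom[OF H(2,4)]])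

lemma cmp_join_right_leI:
  assumes "S \<subseteq> Hom Q X Y" "X \<in> ob Q" "g \<in> Hom Q Y Z" "h \<in> Hom Q X Z"
    "\<And>f. f \<in> S \<Longrightarrow> leq Q (cmp Q g f) h"
  shows "leq Q (cmp Q g (hom_join Q X Y S)) h"
  unfolding cmp_join_right[OF assms(1,3,2)]
  by (rule hom_join_least) (use assms(1,4,5) cmp_Hom[OF _ assms(3)] in auto)

lemma cmp_join_left_leI:
  assumes "S \<subseteq> Hom Q Y Z" "Z \<in> ob Q" "f \<in> Hom Q X Y" "h \<in> Hom Q X Z"
    "\<And>g. g \<in> S \<Longrightarrow> leq Q (cmp Q g f) h"
  shows "leq Q (cmp Q (hom_join Q Y Z S) f) h"
  unfolding cmp_join_left[OF assms(1,3,2)]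
  by (rule hom_join_least) (use assms(1,4,5) cmp_Hom[OF assms(3)] in auto)


section \<open>The quantaloid of distributors\<close>

lemma qcatD:
  assumes "qcategory Q A"
  shows "x \<in> obj A \<Longrightarrow> tp A x \<in> ob Q"
    "x \<in> obj A \<Longrightarrow> y \<in> obj A \<Longrightarrow> hm A x y \<in> Hom Q (tp A x) (tp A y)"
    "x \<in> obj A \<Longrightarrow> leq Q (idt Q (tp A x)) (hm A x x)"
    "x \<in> obj A \<Longrightarrow> y \<in> obj A \<Longrightarrow> z \<in> obj A \<Longrightarrow>
       leq Q (cmp Q (hm A y z) (hm A x y)) (hm A x z)"
  using assms by (auto simp: qcategory_def)

lemma DistD:
  assumes "\<phi> \<in> Dist Q A B"
  shows "x \<in> obj A \<Longrightarrow> y \<in> obj B \<Longrightarrow> \<phi> (x, y) \<in> Hom Q (tp A x) (tp B y)"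
    "x \<in> obj A \<Longrightarrow> y' \<in> obj B \<Longrightarrow> y \<in> obj B \<Longrightarrow>
       leq Q (cmp Q (hm B y' y) (\<phi> (x, y'))) (\<phi> (x, y))"
    "x \<in> obj A \<Longrightarrow> x' \<in> obj A \<Longrightarrow> y \<in> obj B \<Longrightarrow>
       leq Q (cmp Q (\<phi> (x', y)) (hm A x x')) (\<phi> (x, y))"
  using assms by (auto simp: Dist_def PiE_def Pi_def)

lemma DistI:
  assumes "\<And>x y. x \<in> obj A \<Longrightarrow> y \<in> obj B \<Longrightarrow> f x y \<in> Hom Q (tp A x) (tp B y)"
    "\<And>x y' y. x \<in> obj A \<Longrightarrow> y' \<in> obj B \<Longrightarrow> y \<in> obj B \<Longrightarrow>
       leq Q (cmp Q (hm B y' y) (f x y')) (f x y)"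
    "\<And>x x' y. x \<in> obj A \<Longrightarrow> x' \<in> obj A \<Longrightarrow> y \<in> obj B \<Longrightarrow>
       leq Q (cmp Q (f x' y) (hm A x x')) (f x y)"
  shows "(\<lambda>(x, y) \<in> obj A \<times> obj B. f x y) \<in> Dist Q A B"
  using assms by (auto simp: Dist_def)

lemma dist_le_refl: "\<phi> \<in> Dist Q A B \<Longrightarrow> dist_le Q A B \<phi> \<phi>"
  unfolding dist_le_def by (auto intro: leq_refl[OF DistD(1)])

lemma dist_le_trans:
  assumes "dist_le Q A B \<phi> \<psi>" "dist_le Q A B \<psi> \<chi>"
    "\<phi> \<in> Dist Q A B" "\<psi> \<in> Dist Q A B" "\<chi> \<in> Dist Q A B"
  shows "dist_le Q A B \<phi> \<chi>"
  unfolding dist_le_def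
proof (intro ballI)
  fix x y assume o: "x \<in> obj A" "y \<in> obj B"
  show "leq Q (\<phi> (x, y)) (\<chi> (x, y))"
    by (rule leq_trans[OF _ _ assms(3-5)[THEN DistD(1), OF o]])
      (use assms(1,2) o in \<open>auto simp: dist_le_def\<close>)
qed

lemma dist_le_antisym:
  assumes "dist_le Q A B \<phi> \<psi>" "dist_le Q A B \<psi> \<phi>" "\<phi> \<in> Dist Q A B" "\<psi> \<in> Dist Q A B"
  shows "\<phi> = \<psi>"
proof (rule PiE_ext)
  show "\<phi> \<in> (\<Pi>\<^sub>E (x, y) \<in> obj A \<times> obj B. Hom Q (tp A x) (tp B y))"
    "\<psi> \<in> (\<Pi>\<^sub>E (x, y) \<in> obj A \<times> obj B. Hom Q (tp A x) (tp B y))"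
    using assms by (auto simp: Dist_def)
  fix p assume "p \<in> obj A \<times> obj B"
  then obtain x y where p: "p = (x, y)" and o: "x \<in> obj A" "y \<in> obj B" by blast
  show "\<phi> p = \<psi> p"
    unfolding p by (rule leq_antisym[OF _ _ assms(3,4)[THEN DistD(1), OF o]])
      (use assms(1,2) o in \<open>auto simp: dist_le_def\<close>)
qed

lemma dist_id_Dist: "qcategory Q A \<Longrightarrow> dist_id A \<in> Dist Q A A"
  unfolding dist_id_def by (rule DistI) (simp_all add: qcatD(2,4))

lemma comp_family_subset:
  assumes "\<phi> \<in> Dist Q A B" "\<psi> \<in> Dist Q B C" "x \<in> obj A" "z \<in> obj C"
  shows "(\<lambda>y. cmp Q (\<psi> (y, z)) (\<phi> (x, y))) ` obj B \<subseteq> Hom Q (tp A x) (tp C z)"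
  using cmp_Hom[OF DistD(1)[OF assms(1,3)] DistD(1)[OF assms(2) _ assms(4)]] by blast

lemma dist_comp_Hom:
  assumes "\<phi> \<in> Dist Q A B" "\<psi> \<in> Dist Q B C" "x \<in> obj A" "z \<in> obj C"
    "tp A x \<in> ob Q" "tp C z \<in> ob Q"
  shows "dist_comp Q A B C \<psi> \<phi> (x, z) \<in> Hom Q (tp A x) (tp C z)"
  using hom_join_Hom[OF comp_family_subset] assms by (simp add: dist_comp_def)

lemma dist_comp_upper:
  assumes "\<phi> \<in> Dist Q A B" "\<psi> \<in> Dist Q B C" "x \<in> obj A" "y \<in> obj B" "z \<in> obj C"
  shows "leq Q (cmp Q (\<psi> (y, z)) (\<phi> (x, y))) (dist_comp Q A B C \<psi> \<phi> (x, z))"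
  using hom_join_upper[OF _ comp_family_subset[OF assms(1-3,5)]] assms(3-)
  by (simp add: dist_comp_def)

text \<open>
  The workhorse for entering a composite: the two factors need only be bounded by components of the
  distributors, so monotonicity of composition is absorbed here.
\<close>

lemma cmp_le_dist_comp:
  assumes d: "\<phi> \<in> Dist Q A B" "\<psi> \<in> Dist Q B C" "x \<in> obj A" "y \<in> obj B" "z \<in> obj C"
    and H: "f \<in> Hom Q (tp A x) (tp B y)" "g \<in> Hom Q (tp B y) (tp C z)"
    and le: "leq Q f (\<phi> (x, y))" "leq Q g (\<psi> (y, z))"
  shows "leq Q (cmp Q g f) (dist_comp Q A B C \<psi> \<phi> (x, z))"
proof -
  note H' = DistD(1)[OF d(1,3,4)] DistD(1)[OF d(2,4,5)]
  note c = dist_comp_Hom[OF d(1,2,3,5) Hom_ob(1)[OF H(1)] Hom_ob(2)[OF H(2)]]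
  show ?thesis
    by (rule leq_trans[OF cmp_mono[OF le H(1) H'(1) H(2) H'(2)] dist_comp_upper[OF d]
        cmp_Hom[OF H] cmp_Hom[OF H'] c])
qed

lemma dist_comp_least:
  assumes "\<phi> \<in> Dist Q A B" "\<psi> \<in> Dist Q B C" "x \<in> obj A" "z \<in> obj C"
    "h \<in> Hom Q (tp A x) (tp C z)"
    "\<And>y. y \<in> obj B \<Longrightarrow> leq Q (cmp Q (\<psi> (y, z)) (\<phi> (x, y))) h"
  shows "leq Q (dist_comp Q A B C \<psi> \<phi> (x, z)) h"
  using hom_join_least[OF comp_family_subset[OF assms(1-4)] assms(5)] assms(3,4,6)
  by (auto simp add: dist_comp_def)

text \<open>
  Composition preserves joins, so an upper bound for a composite of a composite distributor with an
  arrow is checked summand by summand.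
\<close>

lemma cmp_dist_comp_leI:
  assumes d: "\<phi> \<in> Dist Q A B" "\<psi> \<in> Dist Q B C" "x \<in> obj A" "z \<in> obj C"
    and g: "g \<in> Hom Q (tp C z) Z" "h \<in> Hom Q (tp A x) Z"
    and le: "\<And>y. y \<in> obj B \<Longrightarrow> leq Q (cmp Q (cmp Q g (\<psi> (y, z))) (\<phi> (x, y))) h"
  shows "leq Q (cmp Q g (dist_comp Q A B C \<psi> \<phi> (x, z))) h"
proof -
  have "leq Q (cmp Q g (cmp Q (\<psi> (y, z)) (\<phi> (x, y)))) h" if y: "y \<in> obj B" for y
    unfolding cmp_assoc[OF DistD(1)[OF d(1,3) y] DistD(1)[OF d(2) y d(4)] g(1)]
    by (rule le[OF y])
  then show ?thesis
    using cmp_join_right_leI[OF comp_family_subset[OF d] _ g] Hom_ob(1)[OF g(2)] d(3,4)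
    by (auto simp add: dist_comp_def)
qed

lemma dist_comp_cmp_leI:
  assumes d: "\<phi> \<in> Dist Q A B" "\<psi> \<in> Dist Q B C" "x \<in> obj A" "z \<in> obj C"
    and f: "f \<in> Hom Q W (tp A x)" "h \<in> Hom Q W (tp C z)"
    and le: "\<And>y. y \<in> obj B \<Longrightarrow> leq Q (cmp Q (\<psi> (y, z)) (cmp Q (\<phi> (x, y)) f)) h"
  shows "leq Q (cmp Q (dist_comp Q A B C \<psi> \<phi> (x, z)) f) h"
proof -
  have "leq Q (cmp Q (cmp Q (\<psi> (y, z)) (\<phi> (x, y))) f) h" if y: "y \<in> obj B" for y
    unfolding cmp_assoc[OF f(1) DistD(1)[OF d(1,3) y] DistD(1)[OF d(2) y d(4)], symmetric]
    by (rule le[OF y])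
  then show ?thesis
    using cmp_join_left_leI[OF comp_family_subset[OF d] _ f] Hom_ob(2)[OF f(2)] d(3,4)
    by (auto simp add: dist_comp_def)
qed

lemma dist_comp_Dist:
  assumes A: "qcategory Q A" and C: "qcategory Q C"
    and d: "\<phi> \<in> Dist Q A B" "\<psi> \<in> Dist Q B C"
  shows "dist_comp Q A B C \<psi> \<phi> \<in> Dist Q A C"
proof -
  let ?c = "dist_comp Q A B C \<psi> \<phi>"
  note H = DistD(1)[OF d(1)] DistD(1)[OF d(2)] qcatD(2)[OF A] qcatD(2)[OF C]
  have cH: "?c (x, z) \<in> Hom Q (tp A x) (tp C z)" if "x \<in> obj A" "z \<in> obj C" for x z
    by (rule dist_comp_Hom[OF d that qcatD(1)[OF A that(1)] qcatD(1)[OF C that(2)]])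
  have "leq Q (cmp Q (hm C z' z) (?c (x, z'))) (?c (x, z))"
    if o: "x \<in> obj A" "z' \<in> obj C" "z \<in> obj C" for x z' z
  proof (rule cmp_dist_comp_leI[OF d o(1,2) H(4)[OF o(2,3)] cH[OF o(1,3)]])
    fix y assume y: "y \<in> obj B"
    show "leq Q (cmp Q (cmp Q (hm C z' z) (\<psi> (y, z'))) (\<phi> (x, y))) (?c (x, z))"
      by (rule cmp_le_dist_comp[OF d o(1) y o(3) H(1)[OF o(1) y]
            cmp_Hom[OF H(2)[OF y o(2)] H(4)[OF o(2,3)]] leq_refl[OF H(1)[OF o(1) y]]
            DistD(2)[OF d(2) y o(2,3)]])
  qed
  moreover have "leq Q (cmp Q (?c (x', z)) (hm A x x')) (?c (x, z))"
    if o: "x \<in> obj A" "x' \<in> obj A" "z \<in> obj C" for x x' z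
  proof (rule dist_comp_cmp_leI[OF d o(2,3) H(3)[OF o(1,2)] cH[OF o(1,3)]])
    fix y assume y: "y \<in> obj B"
    show "leq Q (cmp Q (\<psi> (y, z)) (cmp Q (\<phi> (x', y)) (hm A x x'))) (?c (x, z))"
      by (rule cmp_le_dist_comp[OF d o(1) y o(3) cmp_Hom[OF H(3)[OF o(1,2)] H(1)[OF o(2) y]]
            H(2)[OF y o(3)] DistD(3)[OF d(1) o(1,2) y] leq_refl[OF H(2)[OF y o(3)]]])
  qed
  ultimately show ?thesis
    using cH by (auto simp: Dist_def dist_comp_def)
qed

lemma dist_comp_mono:
  assumes A: "qcategory Q A" and C: "qcategory Q C"
    and d: "\<phi> \<in> Dist Q A B" "\<phi>' \<in> Dist Q A B" "\<psi> \<in> Dist Q B C" "\<psi>' \<in> Dist Q B C"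
    and le: "dist_le Q A B \<phi> \<phi>'" "dist_le Q B C \<psi> \<psi>'"
  shows "dist_le Q A C (dist_comp Q A B C \<psi> \<phi>) (dist_comp Q A B C \<psi>' \<phi>')"
  unfolding dist_le_def
proof (intro ballI)
  fix x z assume x: "x \<in> obj A" and z: "z \<in> obj C"
  note H = DistD(1)[OF d(1) x] DistD(1)[OF d(2) x] DistD(1)[OF d(3) _ z] DistD(1)[OF d(4) _ z]
  have cH: "dist_comp Q A B C \<psi>' \<phi>' (x, z) \<in> Hom Q (tp A x) (tp C z)"
    using DistD(1)[OF dist_comp_Dist[OF A C d(2,4)] x z] .
  show "leq Q (dist_comp Q A B C \<psi> \<phi> (x, z)) (dist_comp Q A B C \<psi>' \<phi>' (x, z))"
  proof (rule dist_comp_least[OF d(1,3) x z cH])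
    fix y assume y: "y \<in> obj B"
    show "leq Q (cmp Q (\<psi> (y, z)) (\<phi> (x, y))) (dist_comp Q A B C \<psi>' \<phi>' (x, z))"
      by (rule cmp_le_dist_comp[OF d(2,4) x y z H(1)[OF y] H(3)[OF y]])
        (use le x y z in \<open>auto simp: dist_le_def\<close>)
  qed
qed

lemma dist_comp_assoc:
  assumes A: "qcategory Q A" and B: "qcategory Q B" and C: "qcategory Q C" and D: "qcategory Q D"
    and d: "\<phi> \<in> Dist Q A B" "\<psi> \<in> Dist Q B C" "\<chi> \<in> Dist Q C D"
  shows "dist_comp Q A C D \<chi> (dist_comp Q A B C \<psi> \<phi>)
    = dist_comp Q A B D (dist_comp Q B C D \<chi> \<psi>) \<phi>" (is "?l = ?r")
proof -
  note d1 = dist_comp_Dist[OF A C d(1,2)] and d2 = dist_comp_Dist[OF B D d(2,3)]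
  note l = dist_comp_Dist[OF A D d1 d(3)] and r = dist_comp_Dist[OF A D d(1) d2]
  note H = DistD(1)[OF d(1)] DistD(1)[OF d(2)] DistD(1)[OF d(3)] DistD(1)[OF d1]
    DistD(1)[OF d2] DistD(1)[OF l] DistD(1)[OF r]
  show ?thesis
  proof (rule dist_le_antisym[OF _ _ l r]; unfold dist_le_def; intro ballI)
    fix x w assume x: "x \<in> obj A" and w: "w \<in> obj D"
    show "leq Q (?l (x, w)) (?r (x, w))"
    proof (rule dist_comp_least[OF d1 d(3) x w H(7)[OF x w]])
      fix z assume z: "z \<in> obj C"
      show "leq Q (cmp Q (\<chi> (z, w)) (dist_comp Q A B C \<psi> \<phi> (x, z))) (?r (x, w))"
      proof (rule cmp_dist_comp_leI[OF d(1,2) x z H(3)[OF z w] H(7)[OF x w]])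
        fix y assume y: "y \<in> obj B"
        show "leq Q (cmp Q (cmp Q (\<chi> (z, w)) (\<psi> (y, z))) (\<phi> (x, y))) (?r (x, w))"
          by (rule cmp_le_dist_comp[OF d(1) d2 x y w H(1)[OF x y]
                cmp_Hom[OF H(2)[OF y z] H(3)[OF z w]] leq_refl[OF H(1)[OF x y]]
                dist_comp_upper[OF d(2,3) y z w]])
      qed
    qed
    show "leq Q (?r (x, w)) (?l (x, w))"
    proof (rule dist_comp_least[OF d(1) d2 x w H(6)[OF x w]])
      fix y assume y: "y \<in> obj B"
      show "leq Q (cmp Q (dist_comp Q B C D \<chi> \<psi> (y, w)) (\<phi> (x, y))) (?l (x, w))"
      proof (rule dist_comp_cmp_leI[OF d(2,3) y w H(1)[OF x y] H(6)[OF x w]])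
        fix z assume z: "z \<in> obj C"
        show "leq Q (cmp Q (\<chi> (z, w)) (cmp Q (\<psi> (y, z)) (\<phi> (x, y)))) (?l (x, w))"
          by (rule cmp_le_dist_comp[OF d1 d(3) x z w cmp_Hom[OF H(1)[OF x y] H(2)[OF y z]]
                H(3)[OF z w] dist_comp_upper[OF d(1,2) x y z] leq_refl[OF H(3)[OF z w]]])
      qed
    qed
  qed
qed

lemma dist_comp_id:
  assumes A: "qcategory Q A" and B: "qcategory Q B" and d: "\<phi> \<in> Dist Q A B"
  shows dist_comp_id_right: "dist_comp Q A A B \<phi> (dist_id A) = \<phi>"
    and dist_comp_id_left: "dist_comp Q A B B (dist_id B) \<phi> = \<phi>"
proof -
  note I = dist_id_Dist[OF A] and J = dist_id_Dist[OF B]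
  note l = dist_comp_Dist[OF A B I d] and r = dist_comp_Dist[OF A B d J]
  note H = DistD(1)[OF d] DistD(1)[OF l] DistD(1)[OF r] qcatD(2)[OF A] qcatD(2)[OF B]
    idt_Hom[OF qcatD(1)[OF A]] idt_Hom[OF qcatD(1)[OF B]]
  have idv: "dist_id A (x, y) = hm A x y" if "x \<in> obj A" "y \<in> obj A" for x y
    using that by (simp add: dist_id_def)
  have idw: "dist_id B (x, y) = hm B x y" if "x \<in> obj B" "y \<in> obj B" for x y
    using that by (simp add: dist_id_def)
  show "dist_comp Q A A B \<phi> (dist_id A) = \<phi>"
  proof (rule dist_le_antisym[OF _ _ l d]; unfold dist_le_def; intro ballI)
    fix x y assume x: "x \<in> obj A" and y: "y \<in> obj B"
    show "leq Q (dist_comp Q A A B \<phi> (dist_id A) (x, y)) (\<phi> (x, y))"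
      by (rule dist_comp_least[OF I d x y H(1)[OF x y]]) (simp add: idv x DistD(3)[OF d] y)
    have "leq Q (cmp Q (\<phi> (x, y)) (idt Q (tp A x))) (dist_comp Q A A B \<phi> (dist_id A) (x, y))"
      by (rule cmp_le_dist_comp[OF I d x x y H(6)[OF x] H(1)[OF x y] _ leq_refl[OF H(1)[OF x y]]])
        (simp add: idv x qcatD(3)[OF A])
    then show "leq Q (\<phi> (x, y)) (dist_comp Q A A B \<phi> (dist_id A) (x, y))"
      by (simp add: cmp_idt[OF H(1)[OF x y]])
  qed
  show "dist_comp Q A B B (dist_id B) \<phi> = \<phi>"
  proof (rule dist_le_antisym[OF _ _ r d]; unfold dist_le_def; intro ballI)
    fix x y assume x: "x \<in> obj A" and y: "y \<in> obj B"
    show "leq Q (dist_comp Q A B B (dist_id B) \<phi> (x, y)) (\<phi> (x, y))"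
      by (rule dist_comp_least[OF d J x y H(1)[OF x y]]) (simp add: idw y DistD(2)[OF d] x)
    have "leq Q (cmp Q (idt Q (tp B y)) (\<phi> (x, y))) (dist_comp Q A B B (dist_id B) \<phi> (x, y))"
      by (rule cmp_le_dist_comp[OF d J x y y H(1)[OF x y] H(7)[OF y] leq_refl[OF H(1)[OF x y]]])
        (simp add: idw y qcatD(3)[OF B])
    then show "leq Q (\<phi> (x, y)) (dist_comp Q A B B (dist_id B) \<phi> (x, y))"
      by (simp add: idt_cmp[OF H(1)[OF x y]])
  qed
qed


section \<open>Adjunctions\<close>

lemma adjointD:
  assumes "adjoint Q A B \<zeta> \<xi>"
  shows "\<zeta> \<in> Dist Q A B" "\<xi> \<in> Dist Q B A"
    "dist_le Q A A (dist_id A) (dist_comp Q A B A \<xi> \<zeta>)"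
    "dist_le Q B B (dist_comp Q B A B \<zeta> \<xi>) (dist_id B)"
  using assms by (auto simp: adjoint_def)

text \<open>
  All later inequalities between distributors are moved along adjunctions by these two
  transpositions: post-composition with \<open>\<zeta>\<close> is left adjoint to post-composition with \<open>\<xi>\<close>, whereas
  for pre-composition the roles are exchanged.
\<close>

lemma adjoint_transpose_left:
  assumes Z: "qcategory Q Z" and A: "qcategory Q A" and B: "qcategory Q B"
    and adj: "adjoint Q A B \<zeta> \<xi>"
    and d: "\<alpha> \<in> Dist Q Z A" "\<beta> \<in> Dist Q Z B"
  shows "dist_le Q Z B (dist_comp Q Z A B \<zeta> \<alpha>) \<beta> \<longleftrightarrow> dist_le Q Z A \<alpha> (dist_comp Q Z B A \<xi> \<beta>)"
proof
  note \<zeta> = adjointD(1)[OF adj] and \<xi> = adjointD(2)[OF adj]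
  note I = dist_id_Dist[OF A] and J = dist_id_Dist[OF B]
  note \<zeta>\<alpha> = dist_comp_Dist[OF Z B d(1) \<zeta>] and \<xi>\<beta> = dist_comp_Dist[OF Z A d(2) \<xi>]
  note \<xi>\<zeta> = dist_comp_Dist[OF A A \<zeta> \<xi>] and \<zeta>\<xi> = dist_comp_Dist[OF B B \<xi> \<zeta>]
  \<comment> \<open>The unit composed with \<open>\<alpha>\<close> and the counit composed with \<open>\<beta>\<close>, reassociated.\<close>
  note u = dist_comp_mono[OF Z A d(1) d(1) I \<xi>\<zeta> dist_le_refl[OF d(1)] adjointD(3)[OF adj],
      unfolded dist_comp_id_left[OF Z A d(1)] dist_comp_assoc[OF Z A B A d(1) \<zeta> \<xi>, symmetric]]
  note c = dist_comp_mono[OF Z B d(2) d(2) \<zeta>\<xi> J dist_le_refl[OF d(2)] adjointD(4)[OF adj],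
      unfolded dist_comp_id_left[OF Z B d(2)] dist_comp_assoc[OF Z B A B d(2) \<xi> \<zeta>, symmetric]]
  show "dist_le Q Z A \<alpha> (dist_comp Q Z B A \<xi> \<beta>)" if "dist_le Q Z B (dist_comp Q Z A B \<zeta> \<alpha>) \<beta>"
    by (rule dist_le_trans[OF u dist_comp_mono[OF Z A \<zeta>\<alpha> d(2) \<xi> \<xi> that dist_le_refl[OF \<xi>]]
          d(1) dist_comp_Dist[OF Z A \<zeta>\<alpha> \<xi>] \<xi>\<beta>])
  show "dist_le Q Z B (dist_comp Q Z A B \<zeta> \<alpha>) \<beta>" if "dist_le Q Z A \<alpha> (dist_comp Q Z B A \<xi> \<beta>)"
    by (rule dist_le_trans[OF dist_comp_mono[OF Z B d(1) \<xi>\<beta> \<zeta> \<zeta> that dist_le_refl[OF \<zeta>]] c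
          \<zeta>\<alpha> dist_comp_Dist[OF Z B \<xi>\<beta> \<zeta>] d(2)])
qed

lemma adjoint_transpose_right:
  assumes Z: "qcategory Q Z" and A: "qcategory Q A" and B: "qcategory Q B"
    and adj: "adjoint Q A B \<zeta> \<xi>"
    and d: "\<alpha> \<in> Dist Q A Z" "\<beta> \<in> Dist Q B Z"
  shows "dist_le Q B Z (dist_comp Q B A Z \<alpha> \<xi>) \<beta> \<longleftrightarrow> dist_le Q A Z \<alpha> (dist_comp Q A B Z \<beta> \<zeta>)"
proof
  note \<zeta> = adjointD(1)[OF adj] and \<xi> = adjointD(2)[OF adj]
  note I = dist_id_Dist[OF A] and J = dist_id_Dist[OF B]
  note \<alpha>\<xi> = dist_comp_Dist[OF B Z \<xi> d(1)] and \<beta>\<zeta> = dist_comp_Dist[OF A Z \<zeta> d(2)]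
  note \<xi>\<zeta> = dist_comp_Dist[OF A A \<zeta> \<xi>] and \<zeta>\<xi> = dist_comp_Dist[OF B B \<xi> \<zeta>]
  note u = dist_comp_mono[OF A Z I \<xi>\<zeta> d(1) d(1) adjointD(3)[OF adj] dist_le_refl[OF d(1)],
      unfolded dist_comp_id_right[OF A Z d(1)] dist_comp_assoc[OF A B A Z \<zeta> \<xi> d(1)]]
  note c = dist_comp_mono[OF B Z \<zeta>\<xi> J d(2) d(2) adjointD(4)[OF adj] dist_le_refl[OF d(2)],
      unfolded dist_comp_id_right[OF B Z d(2)] dist_comp_assoc[OF B A B Z \<xi> \<zeta> d(2)]]
  show "dist_le Q A Z \<alpha> (dist_comp Q A B Z \<beta> \<zeta>)" if "dist_le Q B Z (dist_comp Q B A Z \<alpha> \<xi>) \<beta>"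
    by (rule dist_le_trans[OF u dist_comp_mono[OF A Z \<zeta> \<zeta> \<alpha>\<xi> d(2) dist_le_refl[OF \<zeta>] that]
          d(1) dist_comp_Dist[OF A Z \<zeta> \<alpha>\<xi>] \<beta>\<zeta>])
  show "dist_le Q B Z (dist_comp Q B A Z \<alpha> \<xi>) \<beta>" if "dist_le Q A Z \<alpha> (dist_comp Q A B Z \<beta> \<zeta>)"
    by (rule dist_le_trans[OF dist_comp_mono[OF B Z \<xi> \<xi> d(1) \<beta>\<zeta> dist_le_refl[OF \<xi>] that] c
          \<alpha>\<xi> dist_comp_Dist[OF B Z \<xi> \<beta>\<zeta>] d(2)])
qed

lemma adjoint_comp:
  assumes A: "qcategory Q A" and B: "qcategory Q B" and C: "qcategory Q C"
    and adj: "adjoint Q A B \<zeta> \<zeta>'" "adjoint Q B C \<eta> \<eta>'"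
  shows "adjoint Q A C (dist_comp Q A B C \<eta> \<zeta>) (dist_comp Q C B A \<zeta>' \<eta>')"
proof -
  note \<zeta> = adjointD(1)[OF adj(1)] and \<zeta>' = adjointD(2)[OF adj(1)]
  note \<eta> = adjointD(1)[OF adj(2)] and \<eta>' = adjointD(2)[OF adj(2)]
  note l = dist_comp_Dist[OF A C \<zeta> \<eta>] and r = dist_comp_Dist[OF C A \<eta>' \<zeta>']
  \<comment> \<open>Two transpositions take each of the two inequalities to an instance of reflexivity.\<close>
  have "dist_le Q A B \<zeta> (dist_comp Q A C B \<eta>' (dist_comp Q A B C \<eta> \<zeta>))"
    using adjoint_transpose_left[OF A B C adj(2) \<zeta> l] dist_le_refl[OF l] by simp
  then have "dist_le Q A B (dist_comp Q A A B \<zeta> (dist_id A))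
      (dist_comp Q A C B \<eta>' (dist_comp Q A B C \<eta> \<zeta>))"
    by (simp add: dist_comp_id_right[OF A B \<zeta>])
  then have 1: "dist_le Q A A (dist_id A)
      (dist_comp Q A C A (dist_comp Q C B A \<zeta>' \<eta>') (dist_comp Q A B C \<eta> \<zeta>))"
    using adjoint_transpose_left[OF A A B adj(1) dist_id_Dist[OF A] dist_comp_Dist[OF A B l \<eta>']]
    by (simp add: dist_comp_assoc[OF A C B A l \<eta>' \<zeta>'])
  have "dist_le Q C B (dist_comp Q C A B \<zeta> (dist_comp Q C B A \<zeta>' \<eta>')) \<eta>'"
    using adjoint_transpose_left[OF C A B adj(1) r \<eta>'] dist_le_refl[OF r] by simp
  then have "dist_le Q C B (dist_comp Q C A B \<zeta> (dist_comp Q C B A \<zeta>' \<eta>'))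
      (dist_comp Q C C B \<eta>' (dist_id C))"
    by (simp add: dist_comp_id_right[OF C B \<eta>'])
  then have 2: "dist_le Q C C
      (dist_comp Q C A C (dist_comp Q A B C \<eta> \<zeta>) (dist_comp Q C B A \<zeta>' \<eta>')) (dist_id C)"
    using adjoint_transpose_left[OF C B C adj(2) dist_comp_Dist[OF C B r \<zeta>] dist_id_Dist[OF C]]
    by (simp add: dist_comp_assoc[OF C A B C r \<zeta> \<eta>])
  show ?thesis using l r 1 2 by (simp add: adjoint_def)
qed

text \<open>
  The counit of \<open>\<iota> \<circ> \<sigma> \<stileturn> \<rho>\<close> transposes along \<open>\<iota> \<stileturn> \<kappa>\<close> to \<open>\<sigma> \<circ> \<rho> \<le> \<kappa>\<close>. Composing with \<open>\<iota>\<close> and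
  using \<open>\<kappa> \<circ> \<iota> \<le> 1\<close>, the distributor form of full faithfulness, yields the counit of
  \<open>\<sigma> \<stileturn> \<rho> \<circ> \<iota>\<close>. The unit is unchanged up to associativity.
\<close>

lemma adjoint_cancel_embedding:
  assumes A: "qcategory Q A" and B: "qcategory Q B" and P: "qcategory Q P"
    and emb: "adjoint Q A P \<iota> \<kappa>" "dist_le Q A A (dist_comp Q A P A \<kappa> \<iota>) (dist_id A)"
    and \<sigma>: "\<sigma> \<in> Dist Q B A"
    and adj: "adjoint Q B P (dist_comp Q B A P \<iota> \<sigma>) \<rho>"
  shows "adjoint Q B A \<sigma> (dist_comp Q A P B \<rho> \<iota>)"
proof -
  note \<iota> = adjointD(1)[OF emb(1)] and \<kappa> = adjointD(2)[OF emb(1)] and \<rho> = adjointD(2)[OF adj]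
  note \<sigma>\<rho> = dist_comp_Dist[OF P A \<rho> \<sigma>] and \<rho>\<iota> = dist_comp_Dist[OF A B \<iota> \<rho>]
  have unit: "dist_le Q B B (dist_id B) (dist_comp Q B A B (dist_comp Q A P B \<rho> \<iota>) \<sigma>)"
    using adjointD(3)[OF adj] by (simp add: dist_comp_assoc[OF B A P B \<sigma> \<iota> \<rho>])
  have "dist_le Q P P (dist_comp Q P A P \<iota> (dist_comp Q P B A \<sigma> \<rho>)) (dist_id P)"
    using adjointD(4)[OF adj] by (simp add: dist_comp_assoc[OF P B A P \<rho> \<sigma> \<iota>])
  then have le: "dist_le Q P A (dist_comp Q P B A \<sigma> \<rho>) \<kappa>"
    using adjoint_transpose_left[OF P A P emb(1) \<sigma>\<rho> dist_id_Dist[OF P]]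
    by (simp add: dist_comp_id_right[OF P A \<kappa>])
  have "dist_le Q A A (dist_comp Q A P A (dist_comp Q P B A \<sigma> \<rho>) \<iota>) (dist_id A)"
    by (rule dist_le_trans[OF dist_comp_mono[OF A A \<iota> \<iota> \<sigma>\<rho> \<kappa> dist_le_refl[OF \<iota>] le] emb(2)
          dist_comp_Dist[OF A A \<iota> \<sigma>\<rho>] dist_comp_Dist[OF A A \<iota> \<kappa>] dist_id_Dist[OF A]])
  then have counit: "dist_le Q A A (dist_comp Q A B A \<sigma> (dist_comp Q A P B \<rho> \<iota>)) (dist_id A)"
    by (simp add: dist_comp_assoc[OF A P B A \<iota> \<rho> \<sigma>])
  show ?thesis using \<sigma> \<rho>\<iota> unit counit by (simp add: adjoint_def)
qed


section \<open>Functors, graphs and cographs\<close>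

definition qfunctor :: "('o, 'a, 'm) qcat_data \<Rightarrow> ('o, 'b, 'm) qcat_data \<Rightarrow> ('a \<Rightarrow> 'b) \<Rightarrow> bool" where
  "qfunctor A B F \<longleftrightarrow> (\<forall>x\<in>obj A. F x \<in> obj B \<and> tp B (F x) = tp A x) \<and>
     (\<forall>x\<in>obj A. \<forall>y\<in>obj A. leq Q (hm A x y) (hm B (F x) (F y)))"

definition dist_cograph :: "('o, 'a, 'm) qcat_data \<Rightarrow> ('o, 'b, 'm) qcat_data \<Rightarrow>
    ('a \<Rightarrow> 'b) \<Rightarrow> 'b \<times> 'a \<Rightarrow> 'm" where
  "dist_cograph A B F = (\<lambda>(y, x) \<in> obj B \<times> obj A. hm B y (F x))"

lemma qfunctorD:
  assumes "qfunctor A B F"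
  shows "x \<in> obj A \<Longrightarrow> F x \<in> obj B" "x \<in> obj A \<Longrightarrow> tp B (F x) = tp A x"
    "x \<in> obj A \<Longrightarrow> y \<in> obj A \<Longrightarrow> leq Q (hm A x y) (hm B (F x) (F y))"
  using assms by (auto simp: qfunctor_def)

lemma graph_adjoint_cograph:
  assumes A: "qcategory Q A" and B: "qcategory Q B" and F: "qfunctor A B F"
  shows "adjoint Q A B (dist_graph A B F) (dist_cograph A B F)"
proof -
  note F' = qfunctorD[OF F]
  have H: "hm B (F x) y \<in> Hom Q (tp A x) (tp B y)" "hm B y (F x) \<in> Hom Q (tp B y) (tp A x)"
    if "x \<in> obj A" "y \<in> obj B" for x y
    using qcatD(2)[OF B F'(1)[OF that(1)] that(2)] qcatD(2)[OF B that(2) F'(1)[OF that(1)]]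
    by (simp_all add: F'(2)[OF that(1)])
  have FF: "hm B (F x) (F y) \<in> Hom Q (tp A x) (tp A y)" if "x \<in> obj A" "y \<in> obj A" for x y
    using H(1)[OF that(1) F'(1)[OF that(2)]] by (simp add: F'(2)[OF that(2)])
  have g: "dist_graph A B F \<in> Dist Q A B"
    unfolding dist_graph_def
  proof (rule DistI)
    fix x y assume "x \<in> obj A" "y \<in> obj B"
    then show "hm B (F x) y \<in> Hom Q (tp A x) (tp B y)" by (rule H)
  next
    fix x y' y assume "x \<in> obj A" "y' \<in> obj B" "y \<in> obj B"
    then show "leq Q (cmp Q (hm B y' y) (hm B (F x) y')) (hm B (F x) y)"
      using qcatD(4)[OF B] F'(1) by blast
  next
    fix x x' y assume o: "x \<in> obj A" "x' \<in> obj A" "y \<in> obj B"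
    note h = qcatD(2)[OF A o(1,2)] and k = FF[OF o(1,2)] and l = H(1)[OF o(2,3)]
    show "leq Q (cmp Q (hm B (F x') y) (hm A x x')) (hm B (F x) y)"
      by (rule leq_trans[OF cmp_mono_right[OF F'(3)[OF o(1,2)] h k l]
            qcatD(4)[OF B F'(1)[OF o(1)] F'(1)[OF o(2)] o(3)]
            cmp_Hom[OF h l] cmp_Hom[OF k l] H(1)[OF o(1,3)]])
  qed
  have c: "dist_cograph A B F \<in> Dist Q B A"
    unfolding dist_cograph_def
  proof (rule DistI)
    fix y x assume "y \<in> obj B" "x \<in> obj A"
    then show "hm B y (F x) \<in> Hom Q (tp B y) (tp A x)" by (intro H)
  next
    fix y x' x assume o: "y \<in> obj B" "x' \<in> obj A" "x \<in> obj A"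
    note h = qcatD(2)[OF A o(2,3)] and k = FF[OF o(2,3)] and l = H(2)[OF o(2,1)]
    show "leq Q (cmp Q (hm A x' x) (hm B y (F x'))) (hm B y (F x))"
      by (rule leq_trans[OF cmp_mono_left[OF F'(3)[OF o(2,3)] h k l]
            qcatD(4)[OF B o(1) F'(1)[OF o(2)] F'(1)[OF o(3)]]
            cmp_Hom[OF l h] cmp_Hom[OF l k] H(2)[OF o(3,1)]])
  next
    fix y y' x assume "y \<in> obj B" "y' \<in> obj B" "x \<in> obj A"
    then show "leq Q (cmp Q (hm B y' (F x)) (hm B y y')) (hm B y (F x))"
      using qcatD(4)[OF B] F'(1) by blast
  qed
  have "dist_le Q A A (dist_id A) (dist_comp Q A B A (dist_cograph A B F) (dist_graph A B F))"
    unfolding dist_le_def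
  proof (intro ballI)
    fix x z assume x: "x \<in> obj A" and z: "z \<in> obj A"
    note Fx = F'(1)[OF x] and i = idt_Hom[OF qcatD(1)[OF A x]]
    \<comment> \<open>The summand of the composite at \<open>F x\<close> is large enough.\<close>
    have "leq Q (cmp Q (hm A x z) (idt Q (tp A x)))
        (dist_comp Q A B A (dist_cograph A B F) (dist_graph A B F) (x, z))"
    proof (rule cmp_le_dist_comp[OF g c x Fx z])
      show "idt Q (tp A x) \<in> Hom Q (tp A x) (tp B (F x))" using i by (simp add: F'(2)[OF x])
      show "hm A x z \<in> Hom Q (tp B (F x)) (tp A z)"
        using qcatD(2)[OF A x z] by (simp add: F'(2)[OF x])
      show "leq Q (idt Q (tp A x)) (dist_graph A B F (x, F x))"
        using qcatD(3)[OF B Fx] x Fx by (simp add: dist_graph_def F'(2)[OF x])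
      show "leq Q (hm A x z) (dist_cograph A B F (F x, z))"
        using F'(3)[OF x z] z Fx by (simp add: dist_cograph_def)
    qed
    then show "leq Q (dist_id A (x, z))
        (dist_comp Q A B A (dist_cograph A B F) (dist_graph A B F) (x, z))"
      using x z by (simp add: dist_id_def cmp_idt[OF qcatD(2)[OF A x z]])
  qed
  moreover have "dist_le Q B B (dist_comp Q B A B (dist_graph A B F) (dist_cograph A B F)) (dist_id B)"
    unfolding dist_le_def
  proof (intro ballI)
    fix y z assume y: "y \<in> obj B" and z: "z \<in> obj B"
    show "leq Q (dist_comp Q B A B (dist_graph A B F) (dist_cograph A B F) (y, z)) (dist_id B (y, z))"
      by (rule dist_comp_least[OF c g y z])
        (use y z F'(1) qcatD(2)[OF B y z] qcatD(4)[OF B y _ z] in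
          \<open>simp_all add: dist_id_def dist_graph_def dist_cograph_def\<close>)
  qed
  ultimately show ?thesis using g c by (simp add: adjoint_def)
qed

lemma cograph_graph_le_id:
  assumes A: "qcategory Q A" and B: "qcategory Q B" and F: "qfunctor A B F"
    and ff: "\<And>x y. x \<in> obj A \<Longrightarrow> y \<in> obj A \<Longrightarrow> leq Q (hm B (F x) (F y)) (hm A x y)"
  shows "dist_le Q A A (dist_comp Q A B A (dist_cograph A B F) (dist_graph A B F)) (dist_id A)"
  unfolding dist_le_def
proof (intro ballI)
  fix x z assume x: "x \<in> obj A" and z: "z \<in> obj A"
  note gc = graph_adjoint_cograph[OF A B F]
  note Fx = qfunctorD(1)[OF F x] and Fz = qfunctorD(1)[OF F z]
  note t = qfunctorD(2)[OF F x] qfunctorD(2)[OF F z]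
  note h = qcatD(2)[OF A x z]
  show "leq Q (dist_comp Q A B A (dist_cograph A B F) (dist_graph A B F) (x, z)) (dist_id A (x, z))"
  proof (rule dist_comp_least[OF adjointD(1,2)[OF gc] x z])
    show "dist_id A (x, z) \<in> Hom Q (tp A x) (tp A z)" using h x z by (simp add: dist_id_def)
    fix y assume y: "y \<in> obj B"
    have "leq Q (cmp Q (hm B y (F z)) (hm B (F x) y)) (hm A x z)"
      by (rule leq_trans[OF qcatD(4)[OF B Fx y Fz] ff[OF x z]
            cmp_Hom[OF qcatD(2)[OF B Fx y] qcatD(2)[OF B y Fz]] qcatD(2)[OF B Fx Fz]])
        (simp add: t h)
    then show "leq Q (cmp Q (dist_cograph A B F (y, z)) (dist_graph A B F (x, y))) (dist_id A (x, z))"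
      using x y z by (simp add: dist_id_def dist_graph_def dist_cograph_def)
  qed
qed


section \<open>Implications and copresheaves\<close>

text \<open>
  Associativity packaged for chains of estimates: first bound the two outer arrows by \<open>k\<close>, then
  \<open>k\<close> with the innermost one.
\<close>

lemma cmp_cmp_right_le:
  assumes H: "f \<in> Hom Q W X" "g \<in> Hom Q X Y" "h \<in> Hom Q Y Z" "k \<in> Hom Q X Z" "l \<in> Hom Q W Z"
    and le: "leq Q (cmp Q h g) k" "leq Q (cmp Q k f) l"
  shows "leq Q (cmp Q h (cmp Q g f)) l"
  unfolding cmp_assoc[OF H(1,2,3)]
  by (rule leq_trans[OF cmp_mono_left[OF le(1) cmp_Hom[OF H(2,3)] H(4) H(1)] le(2)
        cmp_Hom[OF H(1) cmp_Hom[OF H(2,3)]] cmp_Hom[OF H(1,4)] H(5)])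

definition implication_arrows :: "('o, 'a, 'm) qcat_data \<Rightarrow> ('o, 'b, 'm) qcat_data \<Rightarrow>
    ('o, 'c, 'm) qcat_data \<Rightarrow> ('b \<times> 'c \<Rightarrow> 'm) \<Rightarrow> ('a \<times> 'c \<Rightarrow> 'm) \<Rightarrow> 'a \<Rightarrow> 'b \<Rightarrow> 'm set" where
  "implication_arrows A B C \<gamma> \<eta> x y =
     {f \<in> Hom Q (tp A x) (tp B y). \<forall>z\<in>obj C. leq Q (cmp Q (\<gamma> (y, z)) f) (\<eta> (x, z))}"

text \<open>
  \<open>dist_imp\<close> is a definite description, so its universal property has to be realised by a concrete
  distributor: the pointwise join \<open>t\<close> of the arrows \<open>f\<close> with \<open>\<gamma> (y, z) \<circ> f \<le> \<eta> (x, z)\<close> for all \<open>z\<close>.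
  Because composition preserves joins, \<open>t x y\<close> is itself such an arrow, hence the greatest one.
\<close>

lemma dist_imp_pointwise:
  assumes A: "qcategory Q A" and B: "qcategory Q B"
    and d: "\<gamma> \<in> Dist Q B C" "\<eta> \<in> Dist Q A C"
    and o: "x \<in> obj A" "y \<in> obj B"
  shows dist_imp_Hom: "dist_imp Q A B C \<gamma> \<eta> (x, y) \<in> Hom Q (tp A x) (tp B y)"
    and leq_dist_imp_iff: "f \<in> Hom Q (tp A x) (tp B y) \<Longrightarrow>
      leq Q f (dist_imp Q A B C \<gamma> \<eta> (x, y)) \<longleftrightarrow> (\<forall>z\<in>obj C. leq Q (cmp Q (\<gamma> (y, z)) f) (\<eta> (x, z)))"
proof -
  define t where "t x y = hom_join Q (tp A x) (tp B y) (implication_arrows A B C \<gamma> \<eta> x y)" for x y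
  let ?t = "\<lambda>(x, y) \<in> obj A \<times> obj B. t x y"
  note G = DistD(1)[OF d(1)] and E = DistD(1)[OF d(2)]
  have sub: "implication_arrows A B C \<gamma> \<eta> x y \<subseteq> Hom Q (tp A x) (tp B y)" for x y
    by (auto simp: implication_arrows_def)
  have tH: "t x y \<in> Hom Q (tp A x) (tp B y)" if "x \<in> obj A" "y \<in> obj B" for x y
    unfolding t_def by (rule hom_join_Hom[OF sub qcatD(1)[OF A that(1)] qcatD(1)[OF B that(2)]])
  have ap: "leq Q (cmp Q (\<gamma> (y, z)) (t x y)) (\<eta> (x, z))"
    if "x \<in> obj A" "y \<in> obj B" "z \<in> obj C" for x y z
    unfolding t_def
    by (rule cmp_join_right_leI[OF sub qcatD(1)[OF A that(1)] G[OF that(2,3)] E[OF that(1,3)]])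
      (use that(3) in \<open>auto simp: implication_arrows_def\<close>)
  have greatest: "leq Q f (t x y)"
    if "f \<in> Hom Q (tp A x) (tp B y)" "\<And>z. z \<in> obj C \<Longrightarrow> leq Q (cmp Q (\<gamma> (y, z)) f) (\<eta> (x, z))"
    for f x y
    unfolding t_def
    by (rule hom_join_upper[OF _ sub]) (use that in \<open>auto simp: implication_arrows_def\<close>)
  have iff: "leq Q f (t x y) \<longleftrightarrow> (\<forall>z\<in>obj C. leq Q (cmp Q (\<gamma> (y, z)) f) (\<eta> (x, z)))"
    if o: "x \<in> obj A" "y \<in> obj B" and f: "f \<in> Hom Q (tp A x) (tp B y)" for f x y
  proof
    assume le: "leq Q f (t x y)"
    show "\<forall>z\<in>obj C. leq Q (cmp Q (\<gamma> (y, z)) f) (\<eta> (x, z))"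
    proof
      fix z assume z: "z \<in> obj C"
      show "leq Q (cmp Q (\<gamma> (y, z)) f) (\<eta> (x, z))"
        by (rule leq_trans[OF cmp_mono_right[OF le f tH[OF o] G[OF o(2) z]] ap[OF o z]
              cmp_Hom[OF f G[OF o(2) z]] cmp_Hom[OF tH[OF o] G[OF o(2) z]] E[OF o(1) z]])
    qed
  qed (use greatest[OF f] in blast)
  have tD: "?t \<in> Dist Q A B"
  proof (rule DistI)
    fix x y assume "x \<in> obj A" "y \<in> obj B"
    then show "t x y \<in> Hom Q (tp A x) (tp B y)" by (rule tH)
  next
    fix x y' y assume o: "x \<in> obj A" "y' \<in> obj B" "y \<in> obj B"
    note b = qcatD(2)[OF B o(2,3)]
    show "leq Q (cmp Q (hm B y' y) (t x y')) (t x y)"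
    proof (rule greatest[OF cmp_Hom[OF tH[OF o(1,2)] b]])
      fix z assume z: "z \<in> obj C"
      show "leq Q (cmp Q (\<gamma> (y, z)) (cmp Q (hm B y' y) (t x y'))) (\<eta> (x, z))"
        by (rule cmp_cmp_right_le[OF tH[OF o(1,2)] b G[OF o(3) z] G[OF o(2) z] E[OF o(1) z]
              DistD(3)[OF d(1) o(2,3) z] ap[OF o(1,2) z]])
    qed
  next
    fix x x' y assume o: "x \<in> obj A" "x' \<in> obj A" "y \<in> obj B"
    note a = qcatD(2)[OF A o(1,2)]
    show "leq Q (cmp Q (t x' y) (hm A x x')) (t x y)"
    proof (rule greatest[OF cmp_Hom[OF a tH[OF o(2,3)]]])
      fix z assume z: "z \<in> obj C"
      show "leq Q (cmp Q (\<gamma> (y, z)) (cmp Q (t x' y) (hm A x x'))) (\<eta> (x, z))"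
        by (rule cmp_cmp_right_le[OF a tH[OF o(2,3)] G[OF o(3) z] E[OF o(2) z] E[OF o(1) z]
              ap[OF o(2,3) z] DistD(3)[OF d(2) o(1,2) z]])
    qed
  qed
  have univ: "dist_le Q A C (dist_comp Q A B C \<gamma> \<theta>) \<eta> \<longleftrightarrow> dist_le Q A B \<theta> ?t"
    if \<theta>: "\<theta> \<in> Dist Q A B" for \<theta>
  proof
    assume le: "dist_le Q A C (dist_comp Q A B C \<gamma> \<theta>) \<eta>"
    show "dist_le Q A B \<theta> ?t"
      unfolding dist_le_def
    proof (intro ballI)
      fix x y assume o: "x \<in> obj A" "y \<in> obj B"
      have "leq Q (\<theta> (x, y)) (t x y)"
      proof (rule greatest[OF DistD(1)[OF \<theta> o]])
        fix z assume z: "z \<in> obj C"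
        note c = dist_comp_Hom[OF \<theta> d(1) o(1) z Hom_ob[OF E[OF o(1) z]]]
        show "leq Q (cmp Q (\<gamma> (y, z)) (\<theta> (x, y))) (\<eta> (x, z))"
          by (rule leq_trans[OF dist_comp_upper[OF \<theta> d(1) o z] _
                cmp_Hom[OF DistD(1)[OF \<theta> o] G[OF o(2) z]] c E[OF o(1) z]])
            (use le o z in \<open>simp add: dist_le_def\<close>)
      qed
      then show "leq Q (\<theta> (x, y)) (?t (x, y))" using o by simp
    qed
  next
    assume le: "dist_le Q A B \<theta> ?t"
    show "dist_le Q A C (dist_comp Q A B C \<gamma> \<theta>) \<eta>"
      unfolding dist_le_def
    proof (intro ballI)
      fix x z assume x: "x \<in> obj A" and z: "z \<in> obj C"
      show "leq Q (dist_comp Q A B C \<gamma> \<theta> (x, z)) (\<eta> (x, z))"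
      proof (rule dist_comp_least[OF \<theta> d(1) x z E[OF x z]])
        fix y assume y: "y \<in> obj B"
        have "leq Q (\<theta> (x, y)) (t x y)" using le x y by (simp add: dist_le_def)
        then show "leq Q (cmp Q (\<gamma> (y, z)) (\<theta> (x, y))) (\<eta> (x, z))"
          using iff[OF x y DistD(1)[OF \<theta> x y]] z by blast
      qed
    qed
  qed
  have "dist_imp Q A B C \<gamma> \<eta> = ?t"
    unfolding dist_imp_def
  proof (rule the_equality)
    show "?t \<in> Dist Q A B \<and>
      (\<forall>\<theta>\<in>Dist Q A B. dist_le Q A C (dist_comp Q A B C \<gamma> \<theta>) \<eta> \<longleftrightarrow> dist_le Q A B \<theta> ?t)"
      using tD univ by blast
  next
    fix \<theta> assume "\<theta> \<in> Dist Q A B \<and>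
      (\<forall>\<theta>'\<in>Dist Q A B. dist_le Q A C (dist_comp Q A B C \<gamma> \<theta>') \<eta> \<longleftrightarrow> dist_le Q A B \<theta>' \<theta>)"
    then have \<theta>: "\<theta> \<in> Dist Q A B" and u: "\<And>\<theta>'. \<theta>' \<in> Dist Q A B \<Longrightarrow>
      dist_le Q A B \<theta>' ?t \<longleftrightarrow> dist_le Q A B \<theta>' \<theta>"
      using univ by blast+
    show "\<theta> = ?t"
      by (rule dist_le_antisym[OF _ _ \<theta> tD])
        (use u[OF \<theta>] u[OF tD] dist_le_refl[OF \<theta>] dist_le_refl[OF tD] in blast)+
  qed
  then have eq: "dist_imp Q A B C \<gamma> \<eta> (x, y) = t x y" using o by simp
  show "dist_imp Q A B C \<gamma> \<eta> (x, y) \<in> Hom Q (tp A x) (tp B y)"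
    unfolding eq by (rule tH[OF o])
  show "leq Q f (dist_imp Q A B C \<gamma> \<eta> (x, y)) \<longleftrightarrow>
      (\<forall>z\<in>obj C. leq Q (cmp Q (\<gamma> (y, z)) f) (\<eta> (x, z)))" if "f \<in> Hom Q (tp A x) (tp B y)"
    unfolding eq by (rule iff[OF o that])
qed

text \<open>
  Both implications are described by the same predicate, since \<open>(\<zeta> \<circ> \<mu>) \<circ> \<theta> \<le> \<nu>\<close> transposes to
  \<open>\<mu> \<circ> \<theta> \<le> \<xi> \<circ> \<nu>\<close>. On copresheaves this equality says that \<open>\<nu> \<mapsto> \<xi> \<circ> \<nu>\<close> is, as a functor, left
  adjoint to \<open>\<mu> \<mapsto> \<zeta> \<circ> \<mu>\<close>; the sides are exchanged because the copresheaf category carries the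
  reversed order.
\<close>

lemma dist_imp_adjoint:
  assumes W: "qcategory Q W" and Z: "qcategory Q Z" and A: "qcategory Q A" and B: "qcategory Q B"
    and adj: "adjoint Q A B \<zeta> \<xi>"
    and d: "\<mu> \<in> Dist Q Z A" "\<nu> \<in> Dist Q W B"
  shows "dist_imp Q W Z B (dist_comp Q Z A B \<zeta> \<mu>) \<nu> = dist_imp Q W Z A \<mu> (dist_comp Q W B A \<xi> \<nu>)"
proof -
  have "dist_le Q W B (dist_comp Q W Z B (dist_comp Q Z A B \<zeta> \<mu>) \<theta>) \<nu> \<longleftrightarrow>
      dist_le Q W A (dist_comp Q W Z A \<mu> \<theta>) (dist_comp Q W B A \<xi> \<nu>)"
    if \<theta>: "\<theta> \<in> Dist Q W Z" for \<theta>
    using adjoint_transpose_left[OF W A B adj dist_comp_Dist[OF W A \<theta> d(1)] d(2)]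
    by (simp add: dist_comp_assoc[OF W Z A B \<theta> d(1) adjointD(1)[OF adj]])
  then show ?thesis
    unfolding dist_imp_def by (metis (no_types, lifting))
qed

lemma star_qcategory: "X \<in> ob Q \<Longrightarrow> qcategory Q (star Q X)"
  using idt_Hom[of X] by (simp add: qcategory_def star_def cmp_idt[of _ X X] leq_refl[of _ X X])

lemma star_simps [simp]: "obj (star Q X) = {()}" "tp (star Q X) u = X"
  by (simp_all add: star_def)

lemma copsh_tp [simp]: "tp (copsh Q A) p = fst p"
  by (simp add: copsh_def)

lemma copshD:
  assumes "p \<in> obj (copsh Q A)"
  shows "fst p \<in> ob Q" "snd p \<in> Dist Q (star Q (fst p)) A"
    "a \<in> obj A \<Longrightarrow> snd p ((), a) \<in> Hom Q (fst p) (tp A a)"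
proof -
  show 1: "fst p \<in> ob Q" "snd p \<in> Dist Q (star Q (fst p)) A"
    using assms by (auto simp: copsh_def)
  show "snd p ((), a) \<in> Hom Q (fst p) (tp A a)" if "a \<in> obj A"
    using DistD(1)[OF 1(2) _ that, of "()"] by simp
qed

lemma copsh_hm: "hm (copsh Q A) p q =
    dist_imp Q (star Q (fst p)) (star Q (fst q)) A (snd q) (snd p) ((), ())"
  by (simp add: copsh_def split_beta)

lemma copsh_hm_Hom:
  assumes "p \<in> obj (copsh Q A)" "q \<in> obj (copsh Q A)"
  shows "hm (copsh Q A) p q \<in> Hom Q (fst p) (fst q)"
  using dist_imp_Hom[OF star_qcategory star_qcategory copshD(2)[OF assms(2)] copshD(2)[OF assms(1)],
      of "()" "()"] assms[THEN copshD(1)] by (simp add: copsh_hm)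

lemma leq_copsh_hm_iff:
  assumes "p \<in> obj (copsh Q A)" "q \<in> obj (copsh Q A)" "f \<in> Hom Q (fst p) (fst q)"
  shows "leq Q f (hm (copsh Q A) p q) \<longleftrightarrow>
    (\<forall>a\<in>obj A. leq Q (cmp Q (snd q ((), a)) f) (snd p ((), a)))"
  using leq_dist_imp_iff[OF star_qcategory star_qcategory copshD(2)[OF assms(2)]
      copshD(2)[OF assms(1)], of "()" "()" f] assms(3) assms(1,2)[THEN copshD(1)]
  by (simp add: copsh_hm)

lemma copsh_hm_apply:
  assumes "p \<in> obj (copsh Q A)" "q \<in> obj (copsh Q A)" "a \<in> obj A"
  shows "leq Q (cmp Q (snd q ((), a)) (hm (copsh Q A) p q)) (snd p ((), a))"
  using leq_copsh_hm_iff[OF assms(1,2) copsh_hm_Hom[OF assms(1,2)]]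
    leq_refl[OF copsh_hm_Hom[OF assms(1,2)]] assms(3) by blast

lemma copsh_qcategory: "qcategory Q (copsh Q A)"
proof -
  let ?P = "copsh Q A"
  have "leq Q (idt Q (fst p)) (hm ?P p p)" if p: "p \<in> obj ?P" for p
    unfolding leq_copsh_hm_iff[OF p p idt_Hom[OF copshD(1)[OF p]]]
    by (auto simp: cmp_idt[OF copshD(3)[OF p]] intro: leq_refl[OF copshD(3)[OF p]])
  moreover have "leq Q (cmp Q (hm ?P q r) (hm ?P p q)) (hm ?P p r)"
    if p: "p \<in> obj ?P" and q: "q \<in> obj ?P" and r: "r \<in> obj ?P" for p q r
    unfolding leq_copsh_hm_iff[OF p r cmp_Hom[OF copsh_hm_Hom[OF p q] copsh_hm_Hom[OF q r]]]
  proof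
    fix a assume a: "a \<in> obj A"
    show "leq Q (cmp Q (snd r ((), a)) (cmp Q (hm ?P q r) (hm ?P p q))) (snd p ((), a))"
      by (rule cmp_cmp_right_le[OF copsh_hm_Hom[OF p q] copsh_hm_Hom[OF q r] copshD(3)[OF r a]
            copshD(3)[OF q a] copshD(3)[OF p a] copsh_hm_apply[OF q r a] copsh_hm_apply[OF p q a]])
  qed
  ultimately show ?thesis
    using copshD(1)[where A = A] copsh_hm_Hom[where A = A] by (simp add: qcategory_def)
qed


section \<open>The co-Yoneda embedding and the action on distributors\<close>

lemma coyoneda_simps:
  "fst (coyoneda A a) = tp A a"
  "b \<in> obj A \<Longrightarrow> snd (coyoneda A a) (u, b) = hm A a b"
  by (simp_all add: coyoneda_def)

lemma coyoneda_obj: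
  assumes A: "qcategory Q A" and a: "a \<in> obj A"
  shows "coyoneda A a \<in> obj (copsh Q A)"
proof -
  have "(\<lambda>(u, y) \<in> obj (star Q (tp A a)) \<times> obj A. hm A a y) \<in> Dist Q (star Q (tp A a)) A"
  proof (rule DistI)
    fix u y assume "y \<in> obj A"
    then show "hm A a y \<in> Hom Q (tp (star Q (tp A a)) u) (tp A y)"
      using qcatD(2)[OF A a] by simp
  next
    fix y' y assume "y' \<in> obj A" "y \<in> obj A"
    then show "leq Q (cmp Q (hm A y' y) (hm A a y')) (hm A a y)" by (rule qcatD(4)[OF A a])
  next
    fix u u' y assume y: "y \<in> obj A"
    show "leq Q (cmp Q (hm A a y) (hm (star Q (tp A a)) u u')) (hm A a y)"
      using leq_refl[OF qcatD(2)[OF A a y]] by (simp add: star_def cmp_idt[OF qcatD(2)[OF A a y]])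
  qed
  then show ?thesis using qcatD(1)[OF A a] by (simp add: copsh_def coyoneda_def UNIV_unit)
qed

lemma coyoneda_qfunctor:
  assumes A: "qcategory Q A"
  shows "qfunctor A (copsh Q A) (coyoneda A)"
proof -
  have "leq Q (hm A x y) (hm (copsh Q A) (coyoneda A x) (coyoneda A y))"
    if o: "x \<in> obj A" "y \<in> obj A" for x y
    using leq_copsh_hm_iff[OF coyoneda_obj[OF A o(1)] coyoneda_obj[OF A o(2)], of "hm A x y"]
      qcatD(2,4)[OF A o] by (simp add: coyoneda_simps)
  then show ?thesis
    using coyoneda_obj[OF A] by (simp add: qfunctor_def coyoneda_simps)
qed

lemma coyoneda_full:
  assumes A: "qcategory Q A" and o: "x \<in> obj A" "y \<in> obj A"
  shows "leq Q (hm (copsh Q A) (coyoneda A x) (coyoneda A y)) (hm A x y)"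
proof -
  let ?h = "hm (copsh Q A) (coyoneda A x) (coyoneda A y)"
  note Y = coyoneda_obj[OF A o(1)] coyoneda_obj[OF A o(2)]
  have h: "?h \<in> Hom Q (tp A x) (tp A y)"
    using copsh_hm_Hom[OF Y] by (simp add: coyoneda_simps)
  note i = idt_Hom[OF qcatD(1)[OF A o(2)]] and a = qcatD(2)[OF A o(2,2)]
  \<comment> \<open>Evaluate at \<open>y\<close> and precede the result by the unit of \<open>y\<close>.\<close>
  have 1: "leq Q ?h (cmp Q (hm A y y) ?h)"
    using cmp_mono_left[OF qcatD(3)[OF A o(2)] i a h] by (simp add: idt_cmp[OF h])
  have 2: "leq Q (cmp Q (hm A y y) ?h) (hm A x y)"
    using copsh_hm_apply[OF Y o(2)] by (simp add: coyoneda_simps o)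
  show ?thesis
    by (rule leq_trans[OF 1 2 h cmp_Hom[OF h a] qcatD(2)[OF A o]])
qed

lemma copsh_push_simps:
  "fst (copsh_push Q A B \<sigma> p) = fst p"
  "snd (copsh_push Q A B \<sigma> p) = dist_comp Q (star Q (fst p)) A B \<sigma> (snd p)"
  by (simp_all add: copsh_push_def split_beta)

lemma copsh_push_obj:
  assumes B: "qcategory Q B" and \<sigma>: "\<sigma> \<in> Dist Q A B" and p: "p \<in> obj (copsh Q A)"
  shows "copsh_push Q A B \<sigma> p \<in> obj (copsh Q B)"
  using dist_comp_Dist[OF star_qcategory[OF copshD(1)[OF p]] B copshD(2)[OF p] \<sigma>] copshD(1)[OF p]
  by (simp add: copsh_push_def split_beta copsh_def)

lemma copsh_push_qfunctor:
  assumes B: "qcategory Q B" and \<sigma>: "\<sigma> \<in> Dist Q A B"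
  shows "qfunctor (copsh Q A) (copsh Q B) (copsh_push Q A B \<sigma>)"
proof -
  have "leq Q (hm (copsh Q A) p q) (hm (copsh Q B) (copsh_push Q A B \<sigma> p) (copsh_push Q A B \<sigma> q))"
    if p: "p \<in> obj (copsh Q A)" and q: "q \<in> obj (copsh Q A)" for p q
  proof -
    note P = copsh_push_obj[OF B \<sigma> p] and R = copsh_push_obj[OF B \<sigma> q]
    note h = copsh_hm_Hom[OF p q] and dp = copshD(2)[OF p] and dq = copshD(2)[OF q]
    have h': "hm (copsh Q A) p q \<in> Hom Q (fst p) (tp (star Q (fst q)) ())" using h by simp
    have "leq Q (cmp Q (snd (copsh_push Q A B \<sigma> q) ((), b)) (hm (copsh Q A) p q))
        (snd (copsh_push Q A B \<sigma> p) ((), b))" if b: "b \<in> obj B" for b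
      unfolding copsh_push_simps
    proof (rule dist_comp_cmp_leI[OF dq \<sigma> _ b h'])
      show "dist_comp Q (star Q (fst p)) A B \<sigma> (snd p) ((), b) \<in> Hom Q (fst p) (tp B b)"
        using copshD(3)[OF P b] by (simp add: copsh_push_simps)
      fix a assume a: "a \<in> obj A"
      show "leq Q (cmp Q (\<sigma> (a, b)) (cmp Q (snd q ((), a)) (hm (copsh Q A) p q)))
          (dist_comp Q (star Q (fst p)) A B \<sigma> (snd p) ((), b))"
        by (rule cmp_le_dist_comp[OF dp \<sigma> _ a b _ DistD(1)[OF \<sigma> a b] copsh_hm_apply[OF p q a]
              leq_refl[OF DistD(1)[OF \<sigma> a b]]])
          (simp_all add: cmp_Hom[OF h copshD(3)[OF q a]])
    qed simp
    then show ?thesis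
      using leq_copsh_hm_iff[OF P R, of "hm (copsh Q A) p q"] h by (simp add: copsh_push_simps(1))
  qed
  then show ?thesis
    using copsh_push_obj[OF B \<sigma>] by (simp add: qfunctor_def copsh_push_simps)
qed

lemma copsh_unit_adjoint:
  assumes A: "qcategory Q A"
  shows "adjoint Q A (copsh Q A) (copsh_unit Q A) (dist_cograph A (copsh Q A) (coyoneda A))"
  unfolding copsh_unit_def by (rule graph_adjoint_cograph[OF A copsh_qcategory coyoneda_qfunctor[OF A]])

lemma copsh_map_adjoint_cograph:
  assumes "qcategory Q B" "\<sigma> \<in> Dist Q A B"
  shows "adjoint Q (copsh Q A) (copsh Q B) (copsh_map Q A B \<sigma>)
    (dist_cograph (copsh Q A) (copsh Q B) (copsh_push Q A B \<sigma>))"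
  unfolding copsh_map_def
  by (rule graph_adjoint_cograph[OF copsh_qcategory copsh_qcategory copsh_push_qfunctor[OF assms]])

text \<open>
  The right adjoint of a graph is the cograph, and by \<open>dist_imp_adjoint\<close> the cograph of
  \<open>\<mu> \<mapsto> \<zeta> \<circ> \<mu>\<close> is the graph of \<open>\<nu> \<mapsto> \<xi> \<circ> \<nu>\<close>.
\<close>

lemma copsh_map_adjoint:
  assumes A: "qcategory Q A" and B: "qcategory Q B" and adj: "adjoint Q A B \<zeta> \<xi>"
  shows "adjoint Q (copsh Q A) (copsh Q B) (copsh_map Q A B \<zeta>) (copsh_map Q B A \<xi>)"
proof -
  have "hm (copsh Q B) q (copsh_push Q A B \<zeta> p) = hm (copsh Q A) (copsh_push Q B A \<xi> q) p"
    if p: "p \<in> obj (copsh Q A)" and q: "q \<in> obj (copsh Q B)" for p q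
    using dist_imp_adjoint[OF star_qcategory[OF copshD(1)[OF q]] star_qcategory[OF copshD(1)[OF p]]
        A B adj copshD(2)[OF p] copshD(2)[OF q]]
    by (simp add: copsh_hm copsh_push_simps)
  then have "dist_cograph (copsh Q A) (copsh Q B) (copsh_push Q A B \<zeta>) = copsh_map Q B A \<xi>"
    unfolding dist_cograph_def copsh_map_def dist_graph_def
    by (intro restrict_ext) (auto simp: case_prod_beta)
  then show ?thesis using copsh_map_adjoint_cograph[OF B adjointD(1)[OF adj]] by simp
qed


section \<open>Naturality of the unit\<close>

text \<open>
  A summand \<open>P\<^sup>\<dagger>B(Y b, q) \<circ> \<sigma> (a, b)\<close> of the left side is bounded by the summand of the right side at
  the representable \<open>Y a\<close>, namely \<open>P\<^sup>\<dagger>B(\<sigma> \<circ> Y a, q) \<circ> P\<^sup>\<dagger>A(Y a, Y a)\<close>: composing the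
  former with \<open>q c\<close> gives at most \<open>B(b, c) \<circ> \<sigma> (a, b) \<le> \<sigma> (a, c) \<le> (\<sigma> \<circ> Y a) c\<close>.
\<close>

lemma copsh_unit_oplax_natural:
  assumes A: "qcategory Q A" and B: "qcategory Q B" and \<sigma>: "\<sigma> \<in> Dist Q A B"
  shows "dist_le Q A (copsh Q B)
    (dist_comp Q A B (copsh Q B) (copsh_unit Q B) \<sigma>)
    (dist_comp Q A (copsh Q A) (copsh Q B) (copsh_map Q A B \<sigma>) (copsh_unit Q A))"
proof -
  note uA = adjointD(1)[OF copsh_unit_adjoint[OF A]] and uB = adjointD(1)[OF copsh_unit_adjoint[OF B]]
  note m = adjointD(1)[OF copsh_map_adjoint_cograph[OF B \<sigma>]]
  note r = dist_comp_Dist[OF A copsh_qcategory uA m]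
  show ?thesis
    unfolding dist_le_def
  proof (intro ballI)
    fix a q assume a: "a \<in> obj A" and q: "q \<in> obj (copsh Q B)"
    let ?Y = "coyoneda A a"
    note Y = coyoneda_obj[OF A a] and s = copsh_push_obj[OF B \<sigma> coyoneda_obj[OF A a]]
    show "leq Q (dist_comp Q A B (copsh Q B) (copsh_unit Q B) \<sigma> (a, q))
      (dist_comp Q A (copsh Q A) (copsh Q B) (copsh_map Q A B \<sigma>) (copsh_unit Q A) (a, q))"
    proof (rule dist_comp_least[OF \<sigma> uB a q DistD(1)[OF r a q]])
      fix b assume b: "b \<in> obj B"
      note Yb = coyoneda_obj[OF B b] and sab = DistD(1)[OF \<sigma> a b]
      let ?h = "hm (copsh Q B) (coyoneda B b) q"
      have h: "?h \<in> Hom Q (tp B b) (fst q)"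
        using copsh_hm_Hom[OF Yb q] by (simp add: coyoneda_simps)
      have hs: "cmp Q ?h (\<sigma> (a, b)) \<in> Hom Q (tp A a) (fst q)" by (rule cmp_Hom[OF sab h])
      have "leq Q (cmp Q ?h (\<sigma> (a, b))) (hm (copsh Q B) (copsh_push Q A B \<sigma> ?Y) q)"
      proof (subst leq_copsh_hm_iff[OF s q])
        show "cmp Q ?h (\<sigma> (a, b)) \<in> Hom Q (fst (copsh_push Q A B \<sigma> ?Y)) (fst q)"
          using hs by (simp add: copsh_push_simps coyoneda_simps)
        show "\<forall>c\<in>obj B. leq Q (cmp Q (snd q ((), c)) (cmp Q ?h (\<sigma> (a, b))))
            (snd (copsh_push Q A B \<sigma> ?Y) ((), c))"
        proof
          fix c assume c: "c \<in> obj B"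
          have sac: "\<sigma> (a, c) \<in> Hom Q (tp A a) (tp B c)" by (rule DistD(1)[OF \<sigma> a c])
          have le1: "leq Q (cmp Q (snd q ((), c)) (cmp Q ?h (\<sigma> (a, b)))) (\<sigma> (a, c))"
            by (rule cmp_cmp_right_le[OF sab h copshD(3)[OF q c] qcatD(2)[OF B b c] sac _
                  DistD(2)[OF \<sigma> a b c]])
              (use copsh_hm_apply[OF Yb q c] in \<open>simp add: coyoneda_simps c\<close>)
          \<comment> \<open>The summand of \<open>\<sigma> \<circ> Y a\<close> at \<open>a\<close> contains the unit of \<open>a\<close>.\<close>
          have "leq Q (cmp Q (\<sigma> (a, c)) (idt Q (tp A a))) (snd (copsh_push Q A B \<sigma> ?Y) ((), c))"
            unfolding copsh_push_simps
            by (rule cmp_le_dist_comp[OF copshD(2)[OF Y] \<sigma> _ a c _ sac _ leq_refl[OF sac]])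
              (simp_all add: coyoneda_simps a idt_Hom[OF qcatD(1)[OF A a]] qcatD(3)[OF A a])
          then have le2: "leq Q (\<sigma> (a, c)) (snd (copsh_push Q A B \<sigma> ?Y) ((), c))"
            by (simp add: cmp_idt[OF sac])
          show "leq Q (cmp Q (snd q ((), c)) (cmp Q ?h (\<sigma> (a, b))))
              (snd (copsh_push Q A B \<sigma> ?Y) ((), c))"
            by (rule leq_trans[OF le1 le2 cmp_Hom[OF hs copshD(3)[OF q c]] sac])
              (use copshD(3)[OF s c] in \<open>simp add: copsh_push_simps coyoneda_simps\<close>)
        qed
      qed
      then have le: "leq Q (cmp Q ?h (\<sigma> (a, b))) (copsh_map Q A B \<sigma> (?Y, q))"
        using Y q by (simp add: copsh_map_def dist_graph_def)
      have i: "leq Q (idt Q (tp A a)) (copsh_unit Q A (a, ?Y))"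
        using qcatD(3)[OF copsh_qcategory Y] a Y
        by (simp add: copsh_unit_def dist_graph_def coyoneda_simps)
      have "leq Q (cmp Q (cmp Q ?h (\<sigma> (a, b))) (idt Q (tp A a)))
        (dist_comp Q A (copsh Q A) (copsh Q B) (copsh_map Q A B \<sigma>) (copsh_unit Q A) (a, q))"
        by (rule cmp_le_dist_comp[OF uA m a Y q _ _ i le])
          (simp_all add: coyoneda_simps hs idt_Hom[OF qcatD(1)[OF A a]])
      then show "leq Q (cmp Q (copsh_unit Q B (b, q)) (\<sigma> (a, b)))
        (dist_comp Q A (copsh Q A) (copsh Q B) (copsh_map Q A B \<sigma>) (copsh_unit Q A) (a, q))"
        using b q by (simp add: cmp_idt[OF hs] copsh_unit_def dist_graph_def)
    qed
  qed
qed

text \<open>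
  From left to right, oplax naturality makes the inequality an equality, so the right adjoint
  of \<open>copsh_map Q A B \<sigma> \<circ> copsh_unit Q A\<close> also serves \<open>copsh_unit Q B \<circ> \<sigma>\<close>, from which the embedding
  is cancelled. From right to left, oplax naturality at the right adjoint of \<open>\<sigma>\<close> is transposed.
\<close>

lemma copsh_unit_lax_natural_iff_left_adjoint:
  assumes A: "qcategory Q A" and B: "qcategory Q B" and \<sigma>: "\<sigma> \<in> Dist Q A B"
  shows "dist_le Q A (copsh Q B)
      (dist_comp Q A (copsh Q A) (copsh Q B) (copsh_map Q A B \<sigma>) (copsh_unit Q A))
      (dist_comp Q A B (copsh Q B) (copsh_unit Q B) \<sigma>)
    \<longleftrightarrow> left_adjoint Q A B \<sigma>" (is "dist_le Q A ?PB ?m ?u \<longleftrightarrow> _")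
proof
  let ?PA = "copsh Q A"
  note P = copsh_qcategory
  note adjA = copsh_unit_adjoint[OF A] and adjB = copsh_unit_adjoint[OF B]
  note uA = adjointD(1)[OF adjA] and uB = adjointD(1)[OF adjB]
  note adjm = copsh_map_adjoint_cograph[OF B \<sigma>]
  note m = adjointD(1)[OF adjm]
  note mu = dist_comp_Dist[OF A P uA m] and us = dist_comp_Dist[OF A P \<sigma> uB]
  show "left_adjoint Q A B \<sigma>" if le: "dist_le Q A ?PB ?m ?u"
  proof -
    have eq: "?m = ?u"
      by (rule dist_le_antisym[OF le copsh_unit_oplax_natural[OF A B \<sigma>] mu us])
    have "dist_le Q B B (dist_comp Q B ?PB B (dist_cograph B ?PB (coyoneda B)) (copsh_unit Q B))
        (dist_id B)"
      unfolding copsh_unit_def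
      by (rule cograph_graph_le_id[OF B P coyoneda_qfunctor[OF B] coyoneda_full[OF B]])
    then show ?thesis
      using adjoint_cancel_embedding[OF B A P adjB _ \<sigma>
          adjoint_comp[OF A P P adjA adjm, unfolded eq]]
      by (auto simp: left_adjoint_def)
  qed
  show "dist_le Q A ?PB ?m ?u" if la: "left_adjoint Q A B \<sigma>"
  proof -
    obtain \<xi> where adj: "adjoint Q A B \<sigma> \<xi>" using la by (auto simp: left_adjoint_def)
    note \<xi> = adjointD(2)[OF adj] and adjM = copsh_map_adjoint[OF A B adj]
    note u\<xi> = dist_comp_Dist[OF B P \<xi> uA]
    have "dist_le Q B ?PB (dist_comp Q B ?PA ?PB (copsh_map Q A B \<sigma>)
        (dist_comp Q B A ?PA (copsh_unit Q A) \<xi>)) (copsh_unit Q B)"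
      using adjoint_transpose_left[OF B P P adjM u\<xi> uB] copsh_unit_oplax_natural[OF B A \<xi>] by simp
    then show ?thesis
      using adjoint_transpose_right[OF P A B adj mu uB]
      by (simp add: dist_comp_assoc[OF B A P P \<xi> uA m])
  qed
qed


section \<open>Algebra homomorphisms\<close>

text \<open>
  The algebra structures are left adjoint to the units, so the square of structure maps commutes
  laxly if and only if the naturality square of the unit does.
\<close>

lemma algebra_square_lax_iff_left_adjoint:
  assumes A: "qcategory Q A" and B: "qcategory Q B"
    and alg: "adjoint Q (copsh Q A) A \<phi> (copsh_unit Q A)" "adjoint Q (copsh Q B) B \<psi> (copsh_unit Q B)"
    and \<sigma>: "\<sigma> \<in> Dist Q A B"
  shows "dist_le Q (copsh Q A) B
      (dist_comp Q (copsh Q A) (copsh Q B) B \<psi> (copsh_map Q A B \<sigma>))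
      (dist_comp Q (copsh Q A) A B \<sigma> \<phi>)
    \<longleftrightarrow> left_adjoint Q A B \<sigma>"
proof -
  let ?PA = "copsh Q A" and ?PB = "copsh Q B"
  note P = copsh_qcategory
  note \<phi> = adjointD(1)[OF alg(1)] and uB = adjointD(2)[OF alg(2)]
  note m = adjointD(1)[OF copsh_map_adjoint_cograph[OF B \<sigma>]]
  have "dist_le Q ?PA B (dist_comp Q ?PA ?PB B \<psi> (copsh_map Q A B \<sigma>)) (dist_comp Q ?PA A B \<sigma> \<phi>)
    \<longleftrightarrow> dist_le Q ?PA ?PB (copsh_map Q A B \<sigma>)
      (dist_comp Q ?PA A ?PB (dist_comp Q A B ?PB (copsh_unit Q B) \<sigma>) \<phi>)"
    using adjoint_transpose_left[OF P P B alg(2) m dist_comp_Dist[OF P B \<phi> \<sigma>]]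
    by (simp add: dist_comp_assoc[OF P A B P \<phi> \<sigma> uB])
  also have "\<dots> \<longleftrightarrow> dist_le Q A ?PB (dist_comp Q A ?PA ?PB (copsh_map Q A B \<sigma>) (copsh_unit Q A))
      (dist_comp Q A B ?PB (copsh_unit Q B) \<sigma>)"
    using adjoint_transpose_right[OF P P A alg(1) m dist_comp_Dist[OF A P \<sigma> uB]] by simp
  also have "\<dots> \<longleftrightarrow> left_adjoint Q A B \<sigma>"
    by (rule copsh_unit_lax_natural_iff_left_adjoint[OF A B \<sigma>])
  finally show ?thesis .
qed

text \<open>
  The two halves of the homomorphism equation are lax squares for \<open>\<zeta>\<close> and, after
  transposition, for \<open>\<xi>\<close>; the first is free because \<open>\<zeta>\<close> is a left adjoint.
\<close>

lemma algebra_hom_iff_right_adjoint_is_left_adjoint: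
  assumes A: "copsh_algebra Q A \<phi>" and B: "copsh_algebra Q B \<psi>" and adj: "adjoint Q A B \<zeta> \<xi>"
  shows "copsh_algebra_hom Q A \<phi> B \<psi> \<zeta> \<longleftrightarrow> left_adjoint Q B A \<xi>"
proof -
  let ?PA = "copsh Q A" and ?PB = "copsh Q B"
  let ?l = "dist_comp Q ?PA ?PB B \<psi> (copsh_map Q A B \<zeta>)" and ?r = "dist_comp Q ?PA A B \<zeta> \<phi>"
  have cA: "qcategory Q A" and cB: "qcategory Q B"
    and alg: "adjoint Q ?PA A \<phi> (copsh_unit Q A)" "adjoint Q ?PB B \<psi> (copsh_unit Q B)"
    using A B by (auto simp: copsh_algebra_def)
  note P = copsh_qcategory
  note \<zeta> = adjointD(1)[OF adj] and \<xi> = adjointD(2)[OF adj]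
  note \<phi> = adjointD(1)[OF alg(1)] and \<psi> = adjointD(1)[OF alg(2)]
  note adjM = copsh_map_adjoint[OF cA cB adj]
  note m = adjointD(1)[OF adjM]
  note l = dist_comp_Dist[OF P cB m \<psi>] and r = dist_comp_Dist[OF P cB \<phi> \<zeta>]
  have left: "left_adjoint Q A B \<zeta>" using adj by (auto simp: left_adjoint_def)
  then have "dist_le Q ?PA B ?l ?r"
    by (simp add: algebra_square_lax_iff_left_adjoint[OF cA cB alg \<zeta>])
  then have "copsh_algebra_hom Q A \<phi> B \<psi> \<zeta> \<longleftrightarrow> dist_le Q ?PA B ?r ?l"
    using left dist_le_antisym[OF _ _ l r] dist_le_refl[OF l] by (auto simp: copsh_algebra_hom_def)
  also have "\<dots> \<longleftrightarrow> dist_le Q ?PA A \<phi>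
      (dist_comp Q ?PA ?PB A (dist_comp Q ?PB B A \<xi> \<psi>) (copsh_map Q A B \<zeta>))"
    using adjoint_transpose_left[OF P cA cB adj \<phi> l] by (simp add: dist_comp_assoc[OF P P cB cA m \<psi> \<xi>])
  also have "\<dots> \<longleftrightarrow> dist_le Q ?PB A (dist_comp Q ?PB ?PA A \<phi> (copsh_map Q B A \<xi>))
      (dist_comp Q ?PB B A \<xi> \<psi>)"
    using adjoint_transpose_right[OF cA P P adjM \<phi> dist_comp_Dist[OF P cA \<psi> \<xi>]] by simp
  also have "\<dots> \<longleftrightarrow> left_adjoint Q B A \<xi>"
    by (rule algebra_square_lax_iff_left_adjoint[OF cB cA alg(2,1) \<xi>])
  finally show ?thesis .
qed

end

theorem proposition3p6:
  fixes Q :: "('o, 'm) quantaloid_data"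
    and A :: "('o, 'a, 'm) qcat_data"
    and B :: "('o, 'b, 'm) qcat_data"
    and \<phi> :: "('o, 'a, 'm) copresheaf \<times> 'a \<Rightarrow> 'm"
    and \<psi> :: "('o, 'b, 'm) copresheaf \<times> 'b \<Rightarrow> 'm"
    and \<zeta> :: "'a \<times> 'b \<Rightarrow> 'm"
    and \<zeta>' :: "'b \<times> 'a \<Rightarrow> 'm"
  assumes "quantaloid Q"
    and "copsh_algebra Q A \<phi>"
    and "copsh_algebra Q B \<psi>"
    and "adjoint Q A B \<zeta> \<zeta>'"
  shows "copsh_algebra_hom Q A \<phi> B \<psi> \<zeta> \<longleftrightarrow> left_adjoint Q B A \<zeta>'"
proof -
  interpret quantaloid Q by (rule assms(1))
  show ?thesis
    by (rule algebra_hom_iff_right_adjoint_is_left_adjoint[OF assms(2-4)])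
qed

end
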